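(* Let $\Omega$ be a bounded connected domain of $\mathbb{R}^N$ with $N\ge2$. For $\beta>\lambda_1$ let $$\alpha_\beta=\inf\left\{ \int_\Omega |Du^-|^2dx\ :\ u\in H^1_0(\Omega),\ \|u^+\|_{L^2(\Omega)}=\|u^-\|_{L^2(\Omega)}=1,\ \int_\Omega |Du^+|^2dx=\beta\right\},$$ and for every positive integer $k$ and every $\beta>b_k$ let $\alpha_{k,\beta}$ be the numbers, with $(\alpha_{k,\beta},\beta)\in\Sigma$, described in the context. Then, for every positive integer $k$, there exists $\tilde b_k>0$ (with $\tilde b_k\ge\max\{b_k,\lambda_1\}$, so that both quantities are defined) such that $$\alpha_\beta<\alpha_{k,\beta}\qquad\forall\beta>\tilde b_k.$$
   Context: Notation: $u^\pm=\max\{\pm u,0\}$, so $u=u^+-u^-$; $Du$ is the gradient; $\lambda_1$ is the first eigenvalue of $-\Delta$ in $H^1_0(\Omega)$ and $e_1$ is the corresponding positive eigenfunction normalized in $L^2(\Omega)$. The Fučík spectrum $\Sigma$ is the set of all pairs $(\alpha,\beta)\in\mathbb{R}^2$ such that the Dirichlet problem $\Delta u-\alpha u^-+\beta u^+=0$ in $\Omega$, $u=0$ on $\partial\Omega$, has a nontrivial (weak) solution $u\in H^1_0(\Omega)$, $u\not\equiv0$. The numbers $\alpha_{k,\beta}$: it is known from earlier work that (for $N\ge2$) there is a nondecreasing sequence $(b_k)_k$ of positive numbers and, for every positive integer $k$ and all $\beta>b_k$, there are $\alpha_{k,\beta}>\lambda_1$ and $u_{k,\beta}\in H^1_0(\Omega)$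 with the following properties, and the statement refers to this family. (1) $u_{k,\beta}^+\not\equiv0$, $u_{k,\beta}^-\not\equiv0$ and $\Delta u_{k,\beta}-\alpha_{k,\beta}u_{k,\beta}^-+\beta u_{k,\beta}^+=0$ in $\Omega$ for all $\beta>b_k$; $\alpha_{k,\beta}$ depends continuously on $\beta\in\,]b_k,+\infty[$; $\alpha_{k,\beta}<\alpha_{k+1,\beta}$ for all $\beta>b_{k+1}$; as $\beta\to+\infty$, $\alpha_{k,\beta}\to\lambda_1$ and $u_{k,\beta}\to-e_1$ in $H^1_0(\Omega)$. (2) There exist $r>0$ and, for all $k\ge1$ and $\beta>b_k$, points $x_{1,\beta},\ldots,x_{k,\beta}\in\Omega$ such that the balls $B(x_{i,\beta},r/\sqrt\beta)$, $i=1,\ldots,k$, are pairwise disjoint and included in $\Omega$, $u_{k,\beta}\le0$ in $\Omega\setminus\bigcup_{i=1}^kB(x_{i,\beta},r/\sqrt\beta)$, and $u_{k,\beta}^+\not\equiv0$ in each $B(x_{i,\beta},r/\sqrt\beta)$. As $\beta\to+\infty$, $e_1(x_{i,\beta})\to\max_\Omega e_1$ for every $i$ and $\sqrt\beta\,|x_{i,\beta}-x_{j,\beta}|\to\infty$ for $i\ne j$. With $s_{i,k,\beta}=\sup_{B(x_{i,\beta},r/\sqrt\beta)}u_{k,\beta}$, the rescaled functions $x\mapsto s_{i,k,\beta}^{-1}u_{k,\beta}(x/\sqrt\beta+x_{i,\beta})$ converge, uniformly on compact subsets of $\mathbb{R}^N$, to the radial solution $U$ of $\Delta U+U^+=0$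 in $\mathbb{R}^N$, $U(0)=1$. (3) If $N\ge3$, $$\lim_{\beta\to+\infty}\beta^{\frac{N-2}{2}}(\alpha_{k,\beta}-\lambda_1)=\operatorname{cap}(\bar r_1)\left(\max_\Omega e_1\right)^2k,$$ where $\bar r_1$ is the radius of the balls in $\mathbb{R}^N$ for which the first eigenvalue of $-\Delta$ in $H^1_0$ equals $1$, and $\operatorname{cap}(\bar r_1)>0$ is the capacity of these balls, i.e. $\operatorname{cap}(\bar r_1)=\int_{\mathbb{R}^N\setminus\overline B(0,\bar r_1)}|D\tilde V|^2dx$ with $\Delta\tilde V=0$ in $\mathbb{R}^N\setminus\overline B(0,\bar r_1)$, $\tilde V=1$ on $\partial B(0,\bar r_1)$, $\tilde V(x)\to0$ as $|x|\to\infty$. If $N=2$, $$\lim_{\beta\to+\infty}(\log\beta)\,(\alpha_{k,\beta}-\lambda_1)=4\pi\left(\max_\Omega e_1\right)^2k.$$ *)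

theory Defs
  imports "HOL-Analysis.Analysis"
begin

section \<open>Classical derivatives\<close>

text \<open>Meant for open \<open>S\<close>.\<close>

primrec C_k_on :: "nat \<Rightarrow> 'a::euclidean_space set \<Rightarrow> ('a \<Rightarrow> real) \<Rightarrow> bool" where
  "C_k_on 0 S f \<longleftrightarrow> continuous_on S f"
| "C_k_on (Suc k) S f \<longleftrightarrow>
     (\<forall>x\<in>S. f differentiable (at x)) \<and> (\<forall>b\<in>Basis. C_k_on k S (\<lambda>x. frechet_derivative f (at x) b))"

definition grad :: "('a::euclidean_space \<Rightarrow> real) \<Rightarrow> 'a \<Rightarrow> 'a" where
  "grad f x = (\<Sum>b\<in>Basis. frechet_derivative f (at x) b *\<^sub>R b)"

definition laplacian :: "('a::euclidean_space \<Rightarrow> real) \<Rightarrow> 'a \<Rightarrow> real" where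
  "laplacian f x = (\<Sum>b\<in>Basis. frechet_derivative (\<lambda>y. frechet_derivative f (at y) b) (at x) b)"

definition test_function :: "'a::euclidean_space set \<Rightarrow> ('a \<Rightarrow> real) \<Rightarrow> bool" where
  "test_function \<Omega> \<phi> \<longleftrightarrow>
     (\<forall>k. C_k_on k UNIV \<phi>) \<and> (\<exists>K. compact K \<and> K \<subseteq> \<Omega> \<and> (\<forall>x. x \<notin> K \<longrightarrow> \<phi> x = 0))"


section \<open>Sobolev spaces\<close>

text \<open>Elements of Lebesgue and Sobolev spaces are represented by functions on the whole space, of
  which only the values almost everywhere in \<open>\<Omega>\<close> matter.\<close>

definition square_integrable_on :: "'a::euclidean_space set \<Rightarrow> ('a \<Rightarrow> 'b::euclidean_space) \<Rightarrow> bool" where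
  "square_integrable_on \<Omega> f \<longleftrightarrow>
     f \<in> borel_measurable (lebesgue_on \<Omega>) \<and> integrable (lebesgue_on \<Omega>) (\<lambda>x. (norm (f x))\<^sup>2)"

definition L2_norm_on :: "'a::euclidean_space set \<Rightarrow> ('a \<Rightarrow> 'b::euclidean_space) \<Rightarrow> real" where
  "L2_norm_on \<Omega> f = sqrt (LINT x|lebesgue_on \<Omega>. (norm (f x))\<^sup>2)"

text \<open>\<open>u\<close> lies in \<open>H\<^sup>1(\<Omega>)\<close> and its distributional gradient is \<open>G\<close>, which is unique up to null sets.\<close>

definition has_weak_gradient ::
    "'a::euclidean_space set \<Rightarrow> ('a \<Rightarrow> real) \<Rightarrow> ('a \<Rightarrow> 'a) \<Rightarrow> bool" where
  "has_weak_gradient \<Omega> u G \<longleftrightarrow>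
     square_integrable_on \<Omega> u \<and> square_integrable_on \<Omega> G \<and>
     (\<forall>\<phi>. test_function \<Omega> \<phi> \<longrightarrow> (\<forall>b\<in>Basis.
        (LINT x|lebesgue_on \<Omega>. u x * frechet_derivative \<phi> (at x) b) =
        - (LINT x|lebesgue_on \<Omega>. (G x \<bullet> b) * \<phi> x)))"

definition tendsto_H1 ::
    "'a::euclidean_space set \<Rightarrow> ('i \<Rightarrow> 'a \<Rightarrow> real) \<Rightarrow> ('a \<Rightarrow> real) \<Rightarrow> 'i filter \<Rightarrow> bool" where
  "tendsto_H1 \<Omega> f u F \<longleftrightarrow>
     (\<exists>Df Du. (\<forall>\<^sub>F i in F. has_weak_gradient \<Omega> (f i) (Df i)) \<and> has_weak_gradient \<Omega> u Du \<and>
        ((\<lambda>i. L2_norm_on \<Omega> (\<lambda>x. f i x - u x)) \<longlongrightarrow> 0) F \<and>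
        ((\<lambda>i. L2_norm_on \<Omega> (\<lambda>x. Df i x - Du x)) \<longlongrightarrow> 0) F)"

definition H10 :: "'a::euclidean_space set \<Rightarrow> ('a \<Rightarrow> real) set" where
  "H10 \<Omega> = {u. \<exists>\<phi>. (\<forall>n::nat. test_function \<Omega> (\<phi> n)) \<and> tendsto_H1 \<Omega> \<phi> u sequentially}"

definition nontrivial_on :: "'a::euclidean_space set \<Rightarrow> ('a \<Rightarrow> real) \<Rightarrow> bool" where
  "nontrivial_on \<Omega> u \<longleftrightarrow> \<not> (AE x in lebesgue_on \<Omega>. u x = 0)"

definition pos_part :: "('a \<Rightarrow> real) \<Rightarrow> 'a \<Rightarrow> real" where
  "pos_part u x = max (u x) 0"

definition neg_part :: "('a \<Rightarrow> real) \<Rightarrow> 'a \<Rightarrow> real" where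
  "neg_part u x = max (- u x) 0"


section \<open>Dirichlet problems\<close>

text \<open>\<open>u\<close> is a weak solution of \<open>-\<Delta>u = f\<close> in \<open>\<Omega>\<close>, \<open>u = 0\<close> on \<open>\<partial>\<Omega>\<close>.\<close>

definition weak_dirichlet_solution ::
    "'a::euclidean_space set \<Rightarrow> ('a \<Rightarrow> real) \<Rightarrow> ('a \<Rightarrow> real) \<Rightarrow> bool" where
  "weak_dirichlet_solution \<Omega> f u \<longleftrightarrow>
     u \<in> H10 \<Omega> \<and>
     (\<exists>Du. has_weak_gradient \<Omega> u Du \<and>
        (\<forall>v\<in>H10 \<Omega>. \<forall>Dv. has_weak_gradient \<Omega> v Dv \<longrightarrow>
           (LINT x|lebesgue_on \<Omega>. Du x \<bullet> Dv x) = (LINT x|lebesgue_on \<Omega>. f x * v x)))"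

definition dirichlet_eigenvalue :: "'a::euclidean_space set \<Rightarrow> real \<Rightarrow> bool" where
  "dirichlet_eigenvalue \<Omega> lam \<longleftrightarrow>
     (\<exists>u. weak_dirichlet_solution \<Omega> (\<lambda>x. lam * u x) u \<and> nontrivial_on \<Omega> u)"

definition first_eigenvalue :: "'a::euclidean_space set \<Rightarrow> real \<Rightarrow> bool" where
  "first_eigenvalue \<Omega> lam \<longleftrightarrow>
     dirichlet_eigenvalue \<Omega> lam \<and> (\<forall>\<mu>. dirichlet_eigenvalue \<Omega> \<mu> \<longrightarrow> lam \<le> \<mu>)"

text \<open>The positive normalized eigenfunction of \<open>lam1\<close>. It is evaluated pointwise below, so its
  continuous representative (which exists by interior regularity) is meant.\<close>

definition positive_eigenfunction ::
    "'a::euclidean_space set \<Rightarrow> real \<Rightarrow> ('a \<Rightarrow> real) \<Rightarrow> bool" where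
  "positive_eigenfunction \<Omega> lam1 e1 \<longleftrightarrow>
     weak_dirichlet_solution \<Omega> (\<lambda>x. lam1 * e1 x) e1 \<and> continuous_on \<Omega> e1 \<and>
     (\<forall>x\<in>\<Omega>. 0 < e1 x) \<and> L2_norm_on \<Omega> e1 = 1"

text \<open>The maximum, rendered as a supremum in \<^typ>\<open>ereal\<close>: neither boundedness of the eigenfunction nor
  attainment has to be assumed, and no unspecified value of a real supremum can occur.\<close>

definition max_on :: "'a set \<Rightarrow> ('a \<Rightarrow> real) \<Rightarrow> ereal" where
  "max_on \<Omega> e = (SUP x\<in>\<Omega>. ereal (e x))"

definition fucik_solution ::
    "'a::euclidean_space set \<Rightarrow> real \<Rightarrow> real \<Rightarrow> ('a \<Rightarrow> real) \<Rightarrow> bool" where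
  "fucik_solution \<Omega> \<alpha> \<beta> u \<longleftrightarrow>
     weak_dirichlet_solution \<Omega> (\<lambda>x. \<beta> * pos_part u x - \<alpha> * neg_part u x) u"

definition fucik_spectrum :: "'a::euclidean_space set \<Rightarrow> (real \<times> real) set" where
  "fucik_spectrum \<Omega> = {(\<alpha>, \<beta>). \<exists>u. fucik_solution \<Omega> \<alpha> \<beta> u \<and> nontrivial_on \<Omega> u}"

definition fucik_inf :: "'a::euclidean_space set \<Rightarrow> real \<Rightarrow> real" where
  "fucik_inf \<Omega> \<beta> = Inf {LINT x|lebesgue_on \<Omega>. (norm (Dm x))\<^sup>2 | u Dp Dm.
     u \<in> H10 \<Omega> \<and>
     has_weak_gradient \<Omega> (pos_part u) Dp \<and> has_weak_gradient \<Omega> (neg_part u) Dm \<and>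
     L2_norm_on \<Omega> (pos_part u) = 1 \<and> L2_norm_on \<Omega> (neg_part u) = 1 \<and>
     (LINT x|lebesgue_on \<Omega>. (norm (Dp x))\<^sup>2) = \<beta>}"


section \<open>The family of multi-peak solutions\<close>

text \<open>\<open>c\<close> is the Dirichlet energy of the potential of the compact set \<open>K\<close>, for dimension at least 3.\<close>

definition has_capacity :: "'a::euclidean_space set \<Rightarrow> real \<Rightarrow> bool" where
  "has_capacity K c \<longleftrightarrow>
     (\<exists>V. C_k_on 2 (- K) V \<and> (\<forall>x\<in>- K. laplacian V x = 0) \<and>
        continuous_on (closure (- K)) V \<and> (\<forall>x\<in>frontier K. V x = 1) \<and> (V \<longlongrightarrow> 0) at_infinity \<and>
        c = (LINT x|lebesgue_on (- K). (norm (grad V x))\<^sup>2))"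

definition radial_profile :: "('a::euclidean_space \<Rightarrow> real) \<Rightarrow> bool" where
  "radial_profile U \<longleftrightarrow>
     C_k_on 2 UNIV U \<and> (\<forall>x. laplacian U x + pos_part U x = 0) \<and>
     (\<exists>g. \<forall>x. U x = g (norm x)) \<and> U 0 = 1"

text \<open>In the three predicates below the index \<open>k\<close> runs over the positive integers; \<open>b k\<close>, \<open>\<alpha> k \<beta>\<close> and
  \<open>u k \<beta>\<close> are unconstrained for \<open>k = 0\<close>, and the latter two also for \<open>\<beta> \<le> b k\<close>.
  As for the eigenfunction, \<open>u k \<beta>\<close> denotes the continuous representative.\<close>

definition family_solutions ::
    "'a::euclidean_space set \<Rightarrow> real \<Rightarrow> ('a \<Rightarrow> real) \<Rightarrow> (nat \<Rightarrow> real) \<Rightarrow> (nat \<Rightarrow> real \<Rightarrow> real) \<Rightarrow>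
     (nat \<Rightarrow> real \<Rightarrow> 'a \<Rightarrow> real) \<Rightarrow> bool" where
  "family_solutions \<Omega> lam1 e1 b \<alpha> u \<longleftrightarrow>
     (\<forall>k\<ge>1. 0 < b k \<and> b k \<le> b (Suc k)) \<and>
     (\<forall>k\<ge>1. \<forall>\<beta>>b k.
        \<alpha> k \<beta> > lam1 \<and> fucik_solution \<Omega> (\<alpha> k \<beta>) \<beta> (u k \<beta>) \<and> continuous_on \<Omega> (u k \<beta>) \<and>
        nontrivial_on \<Omega> (pos_part (u k \<beta>)) \<and> nontrivial_on \<Omega> (neg_part (u k \<beta>))) \<and>
     (\<forall>k\<ge>1. continuous_on {b k<..} (\<alpha> k)) \<and>
     (\<forall>k\<ge>1. \<forall>\<beta>>b (Suc k). \<alpha> k \<beta> < \<alpha> (Suc k) \<beta>) \<and>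
     (\<forall>k\<ge>1. (\<alpha> k \<longlongrightarrow> lam1) at_top \<and> tendsto_H1 \<Omega> (u k) (\<lambda>x. - e1 x) at_top)"

text \<open>For fixed \<open>y\<close> the point \<open>y / \<surd>\<beta> + x k i \<beta>\<close> may a priori lie outside \<open>\<Omega>\<close>; there \<open>u k \<beta>\<close> is
  extended by zero.\<close>

definition family_peaks ::
    "'a::euclidean_space set \<Rightarrow> ('a \<Rightarrow> real) \<Rightarrow> (nat \<Rightarrow> real) \<Rightarrow> (nat \<Rightarrow> real \<Rightarrow> 'a \<Rightarrow> real) \<Rightarrow> bool" where
  "family_peaks \<Omega> e1 b u \<longleftrightarrow>
     (\<exists>r>0. \<exists>x :: nat \<Rightarrow> nat \<Rightarrow> real \<Rightarrow> 'a.
        (\<forall>k\<ge>1. \<forall>\<beta>>b k.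
           (\<forall>i\<in>{1..k}. x k i \<beta> \<in> \<Omega> \<and> ball (x k i \<beta>) (r / sqrt \<beta>) \<subseteq> \<Omega>) \<and>
           disjoint_family_on (\<lambda>i. ball (x k i \<beta>) (r / sqrt \<beta>)) {1..k} \<and>
           (\<forall>y\<in>\<Omega> - (\<Union>i\<in>{1..k}. ball (x k i \<beta>) (r / sqrt \<beta>)). u k \<beta> y \<le> 0) \<and>
           (\<forall>i\<in>{1..k}. nontrivial_on (ball (x k i \<beta>) (r / sqrt \<beta>)) (pos_part (u k \<beta>)))) \<and>
        (\<forall>k\<ge>1. \<forall>i\<in>{1..k}. ((\<lambda>\<beta>. ereal (e1 (x k i \<beta>))) \<longlongrightarrow> max_on \<Omega> e1) at_top) \<and>
        (\<forall>k\<ge>1. \<forall>i\<in>{1..k}. \<forall>j\<in>{1..k}. i \<noteq> j \<longrightarrow>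
           filterlim (\<lambda>\<beta>. sqrt \<beta> * dist (x k i \<beta>) (x k j \<beta>)) at_top at_top) \<and>
        (\<exists>U. radial_profile U \<and>
           (\<forall>k\<ge>1. \<forall>i\<in>{1..k}. \<forall>K. compact K \<longrightarrow>
              uniform_limit K
                (\<lambda>\<beta> y. let z = y /\<^sub>R sqrt \<beta> + x k i \<beta> in
                   (if z \<in> \<Omega> then u k \<beta> z else 0) / (SUP w\<in>ball (x k i \<beta>) (r / sqrt \<beta>). u k \<beta> w))
                U at_top)))"

definition family_asymptotics ::
    "'a::euclidean_space set \<Rightarrow> real \<Rightarrow> ('a \<Rightarrow> real) \<Rightarrow> (nat \<Rightarrow> real \<Rightarrow> real) \<Rightarrow> bool" where
  "family_asymptotics \<Omega> lam1 e1 \<alpha> \<longleftrightarrow>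
     (DIM('a) \<ge> 3 \<longrightarrow>
        (\<exists>R c. 0 < R \<and> first_eigenvalue (ball (0::'a) R) 1 \<and>
           0 < c \<and> has_capacity (cball (0::'a) R) c \<and>
           (\<forall>k\<ge>1. ((\<lambda>\<beta>. ereal (\<beta> powr ((real DIM('a) - 2) / 2) * (\<alpha> k \<beta> - lam1)))
                \<longlongrightarrow> ereal c * (max_on \<Omega> e1)\<^sup>2 * ereal (real k)) at_top))) \<and>
     (DIM('a) = 2 \<longrightarrow>
        (\<forall>k\<ge>1. ((\<lambda>\<beta>. ereal (ln \<beta> * (\<alpha> k \<beta> - lam1)))
             \<longlongrightarrow> ereal (4 * pi) * (max_on \<Omega> e1)\<^sup>2 * ereal (real k)) at_top))"

end

theory Submission
  imports Defs
begin

text \<open>The capacity estimate for the \<open>\<alpha>\<^bsub>k,\<beta>\<^esub>\<close> involves the maximum of \<open>e\<^sub>1\<close>, whereas a competitor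
  for \<open>\<alpha>\<^sub>\<beta>\<close> may concentrate its positive part where \<open>e\<^sub>1\<close> is small; such points exist because a
  function of \<open>H\<^sup>1\<^sub>0(\<Omega>)\<close> cannot be bounded below by a positive constant. Fix a ball on which
  \<open>e\<^sub>1 \<le> \<tau>\<close>. The positive part of the competitor is a bump of radius \<open>\<rho> \<sim> \<beta>\<^sup>-\<^sup>1\<^sup>/\<^sup>2\<close> in that ball, its
  negative part is \<open>\<eta> e\<^sub>1\<close> with a cutoff \<open>\<eta>\<close> that vanishes on the support of the bump. Testing the
  equation of \<open>e\<^sub>1\<close> with \<open>\<eta>\<^sup>2 e\<^sub>1\<close> gives
  \<open>\<integral>|D(\<eta> e\<^sub>1)|\<^sup>2 = \<lambda>\<^sub>1 \<integral>\<eta>\<^sup>2 e\<^sub>1\<^sup>2 + \<integral>e\<^sub>1\<^sup>2 |D\<eta>|\<^sup>2\<close>, and the last integral is at most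
  \<open>C \<tau>\<^sup>2 \<beta>\<^sup>-\<^sup>(\<^sup>N\<^sup>-\<^sup>2\<^sup>)\<^sup>/\<^sup>2\<close> for \<open>N \<ge> 3\<close> and \<open>C \<tau>\<^sup>2 / log \<beta>\<close> for \<open>N = 2\<close>. Since \<open>\<tau>\<close> is arbitrarily small, the
  sharp constant \<open>C\<close> is irrelevant, and the known limits for \<open>\<alpha>\<^bsub>k,\<beta>\<^esub> - \<lambda>\<^sub>1\<close> need only be positive.\<close>

section \<open>Smooth functions\<close>

text \<open>The boundary of \<Omega> is arbitrary and \<open>e1\<close> is continuous only inside,
  so its smallness cannot be read off from boundary values; it has to come from the approximation by
  test functions that defines \<open>H10\<close>. Two constraints in \<open>fucik_inf\<close> shape
  the competitor. The weak gradients of both parts must be known: since the bump and the cut-off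
  eigenfunction have disjoint supports, the parts are explicit products, and no truncation rule for
  Sobolev functions enters. The energy of the positive part must equal \<beta> exactly: the
  normalised bump of radius \<rho> has energy \<open>A / \<rho>\<^sup>2\<close> with
  \<open>A\<close> a fixed quotient of integrals, which forces
  \<open>\<rho> = sqrt (A / \<beta>)\<close>. Normalising the negative part costs a factor of at
  most 2, because the ball is small enough to leave half of the mass of \<open>e1\<close>. The
  obstacle in dimension two is scale invariance: a single cutoff has the same energy bound at every
  scale. Averaging \<open>n\<close> dyadic cutoffs divides it by \<open>n\<close>, and a multiple of
  log \<beta> of them fits between \<rho> and the radius of the ball; \<open>n = 1\<close> serves
  all higher dimensions.\<close>

lemma grad_inner: "b \<in> Basis \<Longrightarrow> grad f x \<bullet> b = frechet_derivative f (at x) b"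
  unfolding grad_def by (simp add: inner_sum_left_Basis)

lemma has_derivative_grad:
  assumes "(f has_derivative (\<lambda>v. g \<bullet> v)) (at x)"
  shows "grad f x = g"
proof -
  have "frechet_derivative f (at x) = (\<lambda>v. g \<bullet> v)"
    using frechet_derivative_at[OF assms] by simp
  then show ?thesis
    unfolding grad_def by (simp add: euclidean_representation)
qed

lemma differentiable_has_grad:
  assumes "f differentiable (at x)"
  shows "(f has_derivative (\<lambda>v. grad f x \<bullet> v)) (at x)"
proof -
  have d: "(f has_derivative frechet_derivative f (at x)) (at x)"
    using assms frechet_derivative_works by blast
  then interpret linear "frechet_derivative f (at x)"
    by (rule has_derivative_linear)
  have "frechet_derivative f (at x) v = grad f x \<bullet> v" for v
  proof -
    have "frechet_derivative f (at x) v = frechet_derivative f (at x) (\<Sum>b\<in>Basis. (v \<bullet> b) *\<^sub>R b)"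
      by (simp add: euclidean_representation)
    also have "\<dots> = (\<Sum>b\<in>Basis. (v \<bullet> b) * frechet_derivative f (at x) b)"
      by (simp add: sum scale)
    also have "\<dots> = grad f x \<bullet> v"
      unfolding grad_def by (simp add: inner_sum_left inner_sum_right mult.commute inner_commute)
    finally show ?thesis .
  qed
  then show ?thesis using d by (metis (no_types, lifting) ext)
qed

section \<open>Functions of class C^k: algebra and composition\<close>

lemma C_k_on_Suc_grad:
  "C_k_on (Suc k) UNIV f \<longleftrightarrow>
     (\<forall>x. f differentiable (at x)) \<and> (\<forall>b\<in>Basis. C_k_on k UNIV (\<lambda>x. grad f x \<bullet> b))"
  by (simp add: grad_inner)

lemma C_k_on_Suc_I:
  assumes "\<And>x. (f has_derivative (\<lambda>v. g x \<bullet> v)) (at x)"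
    and "\<And>b. b \<in> Basis \<Longrightarrow> C_k_on k UNIV (\<lambda>x. g x \<bullet> b)"
  shows "C_k_on (Suc k) UNIV f"
proof -
  have "grad f x = g x" for x
    using assms(1) by (rule has_derivative_grad)
  then show ?thesis
    unfolding C_k_on_Suc_grad using assms by (auto simp: differentiable_def)
qed

lemma C_k_on_SucD:
  assumes "C_k_on (Suc k) UNIV f"
  shows "(f has_derivative (\<lambda>v. grad f x \<bullet> v)) (at x)"
    and "b \<in> Basis \<Longrightarrow> C_k_on k UNIV (\<lambda>x. grad f x \<bullet> b)"
  using assms unfolding C_k_on_Suc_grad by (auto intro: differentiable_has_grad)

text \<open>\<open>C_k_on\<close> asks for continuity only at the last order; at lower orders it
  follows from differentiability. The product and chain rules need this because they contain
  undifferentiated factors, which must be of class C^k themselves.\<close>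

lemma C_k_on_Suc_imp:
  "C_k_on (Suc k) UNIV f \<Longrightarrow> C_k_on k UNIV f"
proof (induction k arbitrary: f)
  case 0
  then show ?case
    by (auto intro!: continuous_at_imp_continuous_on differentiable_imp_continuous_within)
next
  case (Suc k)
  have "C_k_on (Suc k) UNIV (\<lambda>x. grad f x \<bullet> b)" if "b \<in> Basis" for b
    using C_k_on_SucD(2)[OF Suc.prems that] .
  then have "C_k_on k UNIV (\<lambda>x. grad f x \<bullet> b)" if "b \<in> Basis" for b
    using Suc.IH that by blast
  then show ?case
    using C_k_on_SucD(1)[OF Suc.prems] by (rule C_k_on_Suc_I[rotated])
qed

lemma C_k_on_const: "C_k_on k UNIV (\<lambda>_. c)"
proof (induction k arbitrary: c)
  case (Suc k)
  show ?case
    by (rule C_k_on_Suc_I[where g = "\<lambda>_. 0"]) (use Suc in auto)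
qed auto

lemma C_k_on_add:
  "C_k_on k UNIV f \<Longrightarrow> C_k_on k UNIV g \<Longrightarrow> C_k_on k UNIV (\<lambda>x. f x + g x)"
proof (induction k arbitrary: f g)
  case 0
  then show ?case by (auto intro: continuous_intros)
next
  case (Suc k)
  note D = C_k_on_SucD[OF Suc.prems(1)] C_k_on_SucD[OF Suc.prems(2)]
  show ?case
  proof (rule C_k_on_Suc_I[where g = "\<lambda>x. grad f x + grad g x"])
    show "((\<lambda>x. f x + g x) has_derivative (\<lambda>v. (grad f x + grad g x) \<bullet> v)) (at x)" for x
      by (auto intro!: derivative_eq_intros D simp: inner_add_left)
  qed (use Suc.IH D in \<open>auto simp: inner_add_left\<close>)
qed

lemma C_k_on_mult:
  "C_k_on k UNIV f \<Longrightarrow> C_k_on k UNIV g \<Longrightarrow> C_k_on k UNIV (\<lambda>x. f x * g x)"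
proof (induction k arbitrary: f g)
  case 0
  then show ?case by (auto intro: continuous_intros)
next
  case (Suc k)
  note D = C_k_on_SucD[OF Suc.prems(1)] C_k_on_SucD[OF Suc.prems(2)]
  show ?case
  proof (rule C_k_on_Suc_I[where g = "\<lambda>x. f x *\<^sub>R grad g x + g x *\<^sub>R grad f x"])
    show "((\<lambda>x. f x * g x) has_derivative
        (\<lambda>v. (f x *\<^sub>R grad g x + g x *\<^sub>R grad f x) \<bullet> v)) (at x)" for x
      by (auto intro!: derivative_eq_intros D simp: inner_add_left algebra_simps)
    show "C_k_on k UNIV (\<lambda>x. (f x *\<^sub>R grad g x + g x *\<^sub>R grad f x) \<bullet> b)" if "b \<in> Basis" for b
      unfolding inner_add_left inner_scaleR_left
      using Suc.prems[THEN C_k_on_Suc_imp] D(2)[OF that] D(4)[OF that]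
      by (intro C_k_on_add Suc.IH)
  qed
qed

lemma C_k_on_compose:
  fixes h :: "real \<Rightarrow> real"
  shows "C_k_on k UNIV h \<Longrightarrow> C_k_on k UNIV f \<Longrightarrow> C_k_on k UNIV (\<lambda>x. h (f x))"
proof (induction k arbitrary: h f)
  case 0
  then show ?case
    using continuous_on_compose2[of UNIV h UNIV f] by simp
next
  case (Suc k)
  note D = C_k_on_SucD[OF Suc.prems(1)] C_k_on_SucD[OF Suc.prems(2)]
  \<comment> \<open>On the real line \<open>Basis\<close> is \<open>{1}\<close>, so the only partial
    derivative is \<open>grad h\<close> itself.\<close>
  have h': "C_k_on k UNIV (grad h)"
    using D(2)[of 1] by simp
  show ?case
  proof (rule C_k_on_Suc_I[where g = "\<lambda>x. grad h (f x) *\<^sub>R grad f x"])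
    show "((\<lambda>x. h (f x)) has_derivative (\<lambda>v. (grad h (f x) *\<^sub>R grad f x) \<bullet> v)) (at x)" for x
      using has_derivative_compose[OF D(3)[of x] D(1)[of "f x"]] by simp
    show "C_k_on k UNIV (\<lambda>x. (grad h (f x) *\<^sub>R grad f x) \<bullet> b)" if "b \<in> Basis" for b
      unfolding inner_scaleR_left
      using Suc.IH[OF h' Suc.prems(2)[THEN C_k_on_Suc_imp]] D(4)[OF that] by (rule C_k_on_mult)
  qed
qed

text \<open>The regularity half of \<open>test_function\<close>, split off so that no order of
  differentiability has to be counted below.\<close>

definition smooth :: "('a::euclidean_space \<Rightarrow> real) \<Rightarrow> bool" where
  "smooth f \<longleftrightarrow> (\<forall>k. C_k_on k UNIV f)"

lemma smooth_const [simp]: "smooth (\<lambda>_. c)"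
  and smooth_add: "smooth f \<Longrightarrow> smooth g \<Longrightarrow> smooth (\<lambda>x. f x + g x)"
  and smooth_mult: "smooth f \<Longrightarrow> smooth g \<Longrightarrow> smooth (\<lambda>x. f x * g x)"
  and smooth_compose: "smooth h \<Longrightarrow> smooth f \<Longrightarrow> smooth (\<lambda>x. h (f x))"
  unfolding smooth_def by (auto intro: C_k_on_const C_k_on_add C_k_on_mult C_k_on_compose)

lemma smooth_minus: "smooth f \<Longrightarrow> smooth (\<lambda>x. - f x)"
  using smooth_mult[OF smooth_const[of "- 1"]] by force

lemma smooth_sum: "(\<And>i. i \<in> I \<Longrightarrow> smooth (f i)) \<Longrightarrow> smooth (\<lambda>x. \<Sum>i\<in>I. f i x)"
  by (induction I rule: infinite_finite_induct) (auto intro: smooth_add)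

lemma smooth_affine: "smooth (\<lambda>x. x \<bullet> v + c)"
proof -
  have "C_k_on k UNIV (\<lambda>x. x \<bullet> v + c)" for k
  proof (cases k)
    case 0
    then show ?thesis by (auto intro!: continuous_intros)
  next
    case (Suc l)
    show ?thesis
      unfolding Suc
      by (rule C_k_on_Suc_I[where g = "\<lambda>_. v"])
        (auto intro!: derivative_eq_intros C_k_on_const simp: inner_commute)
  qed
  then show ?thesis by (simp add: smooth_def)
qed

lemma smooth_inner: "smooth (\<lambda>x. x \<bullet> v)"
  using smooth_affine[of v 0] by simp

text \<open>The square is a polynomial in the coordinates, whereas the distance is not
  differentiable at \<open>a\<close>; the radial cutoffs and bumps are therefore written as
  functions of the squared distance.\<close>

lemma smooth_dist_square: "smooth (\<lambda>x. (norm (x - a))\<^sup>2)"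
proof -
  have "(norm (x - a))\<^sup>2 = (\<Sum>b\<in>Basis. (x \<bullet> b + - (a \<bullet> b)) * (x \<bullet> b + - (a \<bullet> b)))" for x
    unfolding power2_norm_eq_inner by (subst euclidean_inner) (simp add: inner_diff_left)
  then show ?thesis
    by (simp only:) (intro smooth_sum smooth_mult smooth_affine)
qed

section \<open>Gradient calculus for smooth functions\<close>

lemma smooth_has_derivative:
  "smooth f \<Longrightarrow> (f has_derivative (\<lambda>v. grad f x \<bullet> v)) (at x)"
  unfolding smooth_def using C_k_on_SucD(1) by blast

lemma smooth_has_real_derivative:
  fixes h :: "real \<Rightarrow> real"
  assumes "smooth h"
  shows "(h has_real_derivative grad h x) (at x)"
  using smooth_has_derivative[OF assms, of x] by (simp add: has_field_derivative_def)

lemma smooth_grad_inner: "smooth f \<Longrightarrow> b \<in> Basis \<Longrightarrow> smooth (\<lambda>x. grad f x \<bullet> b)"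
  unfolding smooth_def using C_k_on_SucD(2) by blast

lemma smooth_grad_real:
  fixes h :: "real \<Rightarrow> real"
  shows "smooth h \<Longrightarrow> smooth (grad h)"
  using smooth_grad_inner[of h 1] by simp

lemma smooth_continuous_on: "smooth f \<Longrightarrow> continuous_on S f"
  unfolding smooth_def using C_k_on.simps(1) continuous_on_subset by blast

lemma smooth_continuous_on_grad:
  assumes "smooth f"
  shows "continuous_on S (grad f)"
proof -
  have "continuous_on S (\<lambda>x. \<Sum>b\<in>Basis. (grad f x \<bullet> b) *\<^sub>R b)"
    using smooth_grad_inner[OF assms] by (intro continuous_intros smooth_continuous_on) auto
  then show ?thesis by (simp add: euclidean_representation)
qed

lemma grad_mult:
  assumes "smooth f" "smooth g"
  shows "grad (\<lambda>x. f x * g x) x = f x *\<^sub>R grad g x + g x *\<^sub>R grad f x"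
  by (rule has_derivative_grad)
    (auto intro!: derivative_eq_intros smooth_has_derivative assms
      simp: inner_add_left algebra_simps)

lemma grad_sum:
  assumes "\<And>i. i \<in> I \<Longrightarrow> smooth (f i)"
  shows "grad (\<lambda>x. \<Sum>i\<in>I. f i x) x = (\<Sum>i\<in>I. grad (f i) x)"
  by (rule has_derivative_grad)
    (auto intro!: derivative_eq_intros smooth_has_derivative assms simp: inner_sum_left)

lemma grad_compose:
  assumes "smooth h" "smooth f"
  shows "grad (\<lambda>x. h (f x)) x = grad h (f x) *\<^sub>R grad f x"
  by (rule has_derivative_grad)
    (use has_derivative_compose[OF smooth_has_derivative[OF assms(2)]
        smooth_has_derivative[OF assms(1)]] in simp)

lemma grad_const [simp]: "grad (\<lambda>_. c) x = 0"
  by (rule has_derivative_grad) simp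

lemma grad_inner_fun: "grad (\<lambda>x. x \<bullet> v) x = v"
  by (rule has_derivative_grad) (auto intro!: derivative_eq_intros simp: inner_commute)

lemma grad_dist_square: "grad (\<lambda>x. (norm (x - a))\<^sup>2) x = 2 *\<^sub>R (x - a)"
  unfolding power2_norm_eq_inner
  by (rule has_derivative_grad) (auto intro!: derivative_eq_intros simp: inner_commute)

lemma grad_locally_const:
  assumes "open S" "x \<in> S" "\<And>y. y \<in> S \<Longrightarrow> f y = c"
  shows "grad f x = 0"
proof (rule has_derivative_grad)
  have "((\<lambda>_. c) has_derivative (\<lambda>v. 0 \<bullet> v)) (at x)" by simp
  then show "(f has_derivative (\<lambda>v. 0 \<bullet> v)) (at x)"
    by (rule has_derivative_transform_within_open[OF _ assms(1,2)]) (use assms(3) in simp)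
qed

lemma smooth_dilate:
  fixes f :: "real \<Rightarrow> real"
  shows "smooth f \<Longrightarrow> smooth (\<lambda>t. f (t * c))"
  using smooth_compose[OF _ smooth_inner[of c]] by auto

lemma grad_dilate:
  fixes f :: "real \<Rightarrow> real"
  assumes "smooth f"
  shows "grad (\<lambda>t. f (t * c)) t = c * grad f (t * c)"
  using grad_compose[OF assms smooth_inner[of c], of t] grad_inner_fun[of c t] by simp

lemma grad_cmult:
  assumes "smooth f"
  shows "grad (\<lambda>x. c * f x) x = c *\<^sub>R grad f x"
  using grad_mult[OF smooth_const assms, of c x] by simp

lemma lipschitz_of_bounded_grad:
  fixes f :: "real \<Rightarrow> real"
  assumes "smooth f" "\<And>t. \<bar>grad f t\<bar> \<le> K"
  shows "\<bar>f s - f t\<bar> \<le> K * \<bar>s - t\<bar>"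
proof -
  have "norm (f s - f t) \<le> K * norm (s - t)"
    by (rule field_differentiable_bound[where S = UNIV and f' = "grad f"])
      (use assms smooth_has_real_derivative in auto)
  then show ?thesis by simp
qed

lemma bounded_grad_real:
  fixes f :: "real \<Rightarrow> real"
  assumes "smooth f" "\<And>t. t < a \<or> b < t \<Longrightarrow> grad f t = 0"
  shows "\<exists>K>0. \<forall>t. \<bar>grad f t\<bar> \<le> K"
proof -
  have "compact (grad f ` {a..b})"
    using smooth_continuous_on_grad[OF assms(1)] by (rule compact_continuous_image) simp
  then have "bounded (grad f ` {a..b})" by (rule compact_imp_bounded)
  then obtain K where K: "0 < K" "\<forall>y\<in>grad f ` {a..b}. norm y \<le> K"
    unfolding bounded_pos by auto
  have "\<bar>grad f t\<bar> \<le> K" for t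
    using K assms(2)[of t] by (cases "t \<in> {a..b}") auto
  with K(1) show ?thesis by blast
qed

text \<open>The functions \<open>t\<^sup>-\<^sup>m e\<^sup>-\<^sup>1\<^sup>/\<^sup>t\<close> for \<open>t > 0\<close>: their span is closed under differentiation.\<close>

definition flat :: "nat \<Rightarrow> real \<Rightarrow> real" where
  "flat m t = (if t \<le> 0 then 0 else (1 / t) ^ m * exp (- (1 / t)))"

text \<open>With s = 1 / t this is the decay of \<open>s ^ m * exp (- s)\<close> at
  infinity.\<close>

lemma flat_tendsto_0: "(flat m \<longlongrightarrow> 0) (at_right 0)"
proof -
  have "((\<lambda>s. s ^ m * exp (- s)) \<longlongrightarrow> 0) (at_top :: real filter)"
    using tendsto_power_div_exp_0[of m] by (simp add: exp_minus field_simps)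
  moreover have "filterlim (\<lambda>t::real. 1 / t) at_top (at_right 0)"
    using filterlim_inverse_at_top_right by (simp add: inverse_eq_divide)
  ultimately have "((\<lambda>t. (1 / t) ^ m * exp (- (1 / t))) \<longlongrightarrow> 0) (at_right (0::real))"
    by (rule filterlim_compose)
  then show ?thesis
    by (rule Lim_transform_eventually) (auto simp: flat_def eventually_at_right_less eventually_at_filter)
qed

lemma flat_has_derivative:
  "(flat m has_real_derivative flat (m + 2) t - m * flat (m + 1) t) (at t)"
proof -
  consider "t < 0" | "t > 0" | "t = 0" by linarith
  then show ?thesis
  proof cases
    case 1
    have "((\<lambda>_. 0) has_real_derivative 0) (at t)" by simp
    then have "(flat m has_real_derivative 0) (at t)"
      by (rule has_field_derivative_transform_within_open[where S = "{..<0}"])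
        (use 1 in \<open>auto simp: flat_def\<close>)
    then show ?thesis using 1 by (simp add: flat_def)
  next
    case 2
    have inv: "((\<lambda>t. 1 / t) has_real_derivative - ((1 / t)\<^sup>2)) (at t)"
      using 2 by (auto intro!: derivative_eq_intros simp: power2_eq_square)
    have "((\<lambda>s. s ^ m * exp (- s)) has_real_derivative
        m * s ^ (m - 1) * exp (- s) - s ^ m * exp (- s)) (at s)" for s :: real
      by (auto intro!: derivative_eq_intros simp: algebra_simps)
    from DERIV_chain2[OF this inv]
    have "((\<lambda>t. (1 / t) ^ m * exp (- (1 / t))) has_real_derivative
        (m * (1 / t) ^ (m - 1) * exp (- (1 / t)) - (1 / t) ^ m * exp (- (1 / t))) * - ((1 / t)\<^sup>2)) (at t)" .
    \<comment> \<open>For \<open>m = 0\<close> the exponent \<open>m - 1\<close> is truncated to 0,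
      but the factor \<open>m\<close> removes the term.\<close>
    moreover have "(m * s ^ (m - 1) * e - s ^ m * e) * - (s\<^sup>2) = s ^ (m + 2) * e - m * (s ^ (m + 1) * e)"
      for s e :: real
      by (cases m) (auto simp: algebra_simps power2_eq_square)
    ultimately have "((\<lambda>t. (1 / t) ^ m * exp (- (1 / t))) has_real_derivative
        (1 / t) ^ (m + 2) * exp (- (1 / t)) - m * ((1 / t) ^ (m + 1) * exp (- (1 / t)))) (at t)"
      by (simp only:)
    then have "(flat m has_real_derivative
        (1 / t) ^ (m + 2) * exp (- (1 / t)) - m * ((1 / t) ^ (m + 1) * exp (- (1 / t)))) (at t)"
      by (rule has_field_derivative_transform_within_open[where S = "{0<..}"])
        (use 2 in \<open>auto simp: flat_def\<close>)
    then show ?thesis using 2 by (simp add: flat_def)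
  next
    case 3
    \<comment> \<open>To the right of 0 the difference quotient of \<open>flat m\<close> is
      \<open>flat (m + 1)\<close>: dividing by t raises the power of 1 / t by one.\<close>
    have r: "((\<lambda>t. (flat m t - flat m 0) / (t - 0)) \<longlongrightarrow> 0) (at_right 0)"
      by (rule Lim_transform_eventually[OF flat_tendsto_0[of "m + 1"]])
        (auto simp: flat_def eventually_at_filter)
    have l: "((\<lambda>t. (flat m t - flat m 0) / (t - 0)) \<longlongrightarrow> 0) (at_left 0)"
      by (rule Lim_transform_eventually[OF tendsto_const])
        (auto simp: flat_def eventually_at_filter)
    have "(flat m has_real_derivative 0) (at 0)"
      unfolding has_field_derivative_iff using r l by (simp add: filterlim_split_at)
    then show ?thesis using 3 by (simp add: flat_def)
  qed
qed

text \<open>The induction on the order runs over all \<open>m\<close> at once, because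
  differentiating \<open>flat m\<close> leads to \<open>flat (m + 1)\<close> and
  \<open>flat (m + 2)\<close>.\<close>

lemma smooth_flat: "smooth (flat m)"
proof -
  have "C_k_on k UNIV (flat m)" for k
  proof (induction k arbitrary: m)
    case 0
    show ?case
      using flat_has_derivative
      by (auto intro!: continuous_at_imp_continuous_on DERIV_isCont)
  next
    case (Suc k)
    have "C_k_on k UNIV (\<lambda>t. flat (m + 2) t + (- real m) * flat (m + 1) t)"
      by (intro C_k_on_add C_k_on_mult C_k_on_const Suc.IH)
    then have "C_k_on k UNIV (\<lambda>t. flat (m + 2) t - m * flat (m + 1) t)" by simp
    then show ?case
      using flat_has_derivative[of m]
      by (intro C_k_on_Suc_I[where g = "\<lambda>t. flat (m + 2) t - m * flat (m + 1) t"])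
        (auto simp: has_field_derivative_def)
  qed
  then show ?thesis by (simp add: smooth_def)
qed

lemma flat_0_eq: "flat 0 t = (if t \<le> 0 then 0 else exp (- (1 / t)))"
  by (simp add: flat_def)

lemma flat_0_mono: "s \<le> t \<Longrightarrow> flat 0 s \<le> flat 0 t"
  by (auto simp: flat_0_eq divide_simps)

lemma flat_0_nonneg: "0 \<le> flat 0 t"
  by (simp add: flat_0_eq)

text \<open>Applying the flat function twice gives a smooth function that is constant on both ends.\<close>

definition step :: "real \<Rightarrow> real" where
  "step t = 1 - flat 0 (flat 0 1 - flat 0 ((t - 1) / 3)) / flat 0 (flat 0 1)"

lemma smooth_step: "smooth step"
proof -
  have "smooth (\<lambda>t::real. 1 + - (1 / flat 0 (flat 0 1)) *
      flat 0 (flat 0 1 + - flat 0 (t \<bullet> (1 / 3) + (- 1 / 3))))"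
    by (intro smooth_add smooth_mult smooth_minus smooth_const smooth_affine
        smooth_compose[OF smooth_flat])
  moreover have "step = (\<lambda>t. 1 + - (1 / flat 0 (flat 0 1)) *
      flat 0 (flat 0 1 + - flat 0 (t \<bullet> (1 / 3) + (- 1 / 3))))"
    by (auto simp: step_def diff_divide_distrib)
  ultimately show ?thesis by simp
qed

text \<open>The thresholds 1 and 4 are the squares of 1 and 2: with the squared distance divided by
  \<open>s\<^sup>2\<close> as argument, the transition takes place in the annulus between the radii
  s and 2s.\<close>

lemma step_0: "t \<le> 1 \<Longrightarrow> step t = 0"
  by (simp add: step_def flat_0_eq)

lemma step_1: "4 \<le> t \<Longrightarrow> step t = 1"
  using flat_0_mono[of 1 "(t - 1) / 3"] by (simp add: step_def flat_0_eq)

lemma step_bounds: "0 \<le> step t" "step t \<le> 1"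
proof -
  have p: "flat 0 (flat 0 1) > 0" by (simp add: flat_0_eq)
  have "flat 0 (flat 0 1 - flat 0 ((t - 1) / 3)) \<le> flat 0 (flat 0 1)"
    using flat_0_nonneg by (intro flat_0_mono) simp
  then show "0 \<le> step t" using p by (simp add: step_def)
  show "step t \<le> 1"
    using p flat_0_nonneg by (simp add: step_def)
qed

text \<open>Outside \<open>[1, 4]\<close> the step is locally constant; at 1 and 4 the derivative is
  a one-sided limit of zeros. The endpoints matter because the annuli of consecutive dyadic scales
  touch there.\<close>

lemma grad_step_eq_0: "t \<le> 1 \<or> 4 \<le> t \<Longrightarrow> grad step t = 0"
proof -
  have lim: "(grad step \<longlongrightarrow> grad step t) (at t within S)" for S
    using smooth_continuous_on_grad[OF smooth_step, of UNIV]
    by (meson UNIV_I continuous_on_def continuous_within top_greatest tendsto_within_subset)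
  have *: "grad step s = 0" if "s < 1 \<or> 4 < s" for s
  proof (cases "s < 1")
    case True
    then show ?thesis
      using grad_locally_const[of "{..<1}" s step 0] step_0 by auto
  next
    case False
    then show ?thesis
      using that grad_locally_const[of "{4<..}" s step 1] step_1 by auto
  qed
  assume t: "t \<le> 1 \<or> 4 \<le> t"
  show ?thesis
  proof (cases "t \<le> 1")
    case True
    have "((\<lambda>_. 0) \<longlongrightarrow> grad step t) (at_left t)"
      by (rule Lim_transform_eventually[OF lim]) (use * True in \<open>auto simp: eventually_at_filter\<close>)
    then show ?thesis by (simp add: tendsto_const_iff)
  next
    case False
    then have "4 \<le> t" using t by simp
    then have "((\<lambda>_. 0) \<longlongrightarrow> grad step t) (at_right t)"
      by (intro Lim_transform_eventually[OF lim]) (use * in \<open>auto simp: eventually_at_filter\<close>)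
    then show ?thesis by (simp add: tendsto_const_iff)
  qed
qed

lemma grad_step_bound: "\<exists>K>0. \<forall>t. \<bar>grad step t\<bar> \<le> K"
  using grad_step_eq_0 by (intro bounded_grad_real[OF smooth_step, of 1 4]) auto

text \<open>A bound on the second derivative makes the derivative of a rescaled step Lipschitz,
  hence small at values close to the range where it vanishes.\<close>

lemma grad_grad_step_bound: "\<exists>K>0. \<forall>t. \<bar>grad (grad step) t\<bar> \<le> K"
proof (rule bounded_grad_real[OF smooth_grad_real[OF smooth_step], of 1 4])
  fix t :: real assume "t < 1 \<or> 4 < t"
  then show "grad (grad step) t = 0"
    using grad_locally_const[of "{..<1}" t "grad step" 0]
      grad_locally_const[of "{4<..}" t "grad step" 0] grad_step_eq_0 by auto
qed

section \<open>Integration by parts\<close>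

lemma integrable_continuous_compact_support:
  fixes f :: "'a::euclidean_space \<Rightarrow> real"
  assumes "continuous_on UNIV f" "compact K" "\<forall>x. x \<notin> K \<longrightarrow> f x = 0"
  shows "integrable lborel f"
proof -
  have "(\<lambda>x. indicator K x *\<^sub>R f x) = f"
    using assms(3) by (auto simp: indicator_def fun_eq_iff)
  then show ?thesis
    using borel_integrable_compact[OF assms(2) continuous_on_subset[OF assms(1)]] by simp
qed

text \<open>Integrals over \<Omega> refer to the completed measure, while translation and scaling
  are carried out in \<open>lborel\<close>; this is the passage between them.\<close>

lemma integral_lebesgue_on_eq_lborel:
  fixes f :: "'a::euclidean_space \<Rightarrow> real"
  assumes "S \<in> sets lebesgue" "f \<in> borel_measurable borel" "\<And>x. x \<notin> S \<Longrightarrow> f x = 0"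
  shows "(LINT x|lebesgue_on S. f x) = (LINT x|lborel. f x)"
proof -
  have "(\<lambda>x. indicator S x *\<^sub>R f x) = f"
    using assms(3) by (auto simp: indicator_def fun_eq_iff)
  then have "(LINT x|lebesgue_on S. f x) = (LINT x|lebesgue. f x)"
    using assms(1) by (simp add: integral_restrict_space)
  then show ?thesis
    using assms(2) by (simp add: integral_completion)
qed

lemma integral_lborel_translation:
  fixes f :: "'a::euclidean_space \<Rightarrow> real"
  assumes "f \<in> borel_measurable borel"
  shows "(LINT x|lborel. f (c + x)) = (LINT x|lborel. f x)"
  by (subst (2) lborel_distr_plus[of c, symmetric]) (use assms in \<open>simp add: integral_distr\<close>)

lemma integral_lborel_scaling:
  fixes f :: "'a::euclidean_space \<Rightarrow> real"
  assumes "f \<in> borel_measurable borel" "0 < \<rho>"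
  shows "(LINT x|lborel. f ((1 / \<rho>) *\<^sub>R (x - a))) = \<rho> ^ DIM('a) * (LINT x|lborel. f x)"
proof -
  have [measurable]: "f \<in> borel_measurable borel" by fact
  have "(LINT x|lborel. f ((1 / \<rho>) *\<^sub>R (x - a)))
      = (LINT x|density (distr lborel borel (\<lambda>x. a + \<rho> *\<^sub>R x)) (\<lambda>_. \<bar>\<rho>\<bar> ^ DIM('a)). f ((1 / \<rho>) *\<^sub>R (x - a)))"
    using assms(2) lborel_affine[of \<rho> a] by simp
  also have "\<dots> = (LINT x|lborel. \<rho> ^ DIM('a) * f x)"
    using assms(2) by (subst integral_density) (auto simp: integral_distr)
  finally show ?thesis by simp
qed

lemma grad_eq_0_outside_support:
  assumes "compact K" "\<forall>x. x \<notin> K \<longrightarrow> f x = 0" "x \<notin> K"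
  shows "grad f x = 0"
  by (rule grad_locally_const[of "- K"]) (use assms compact_imp_closed in auto)

text \<open>The integral of \<open>f (x + t b)\<close> does not depend on \<open>t\<close>; differentiate under the integral sign.\<close>

lemma integral_grad_eq_0:
  fixes f :: "'a::euclidean_space \<Rightarrow> real"
  assumes f: "smooth f" and K: "compact K" "\<forall>x. x \<notin> K \<longrightarrow> f x = 0" and b: "b \<in> Basis"
  shows "(LINT x|lborel. grad f x \<bullet> b) = 0"
proof -
  let ?q = "\<lambda>n x. (f (inverse (real (Suc n)) *\<^sub>R b + x) - f x) / inverse (real (Suc n))"
  note grad0 = grad_eq_0_outside_support[OF K]
  have [measurable]: "f \<in> borel_measurable borel"
    using smooth_continuous_on[OF f] by (rule borel_measurable_continuous_onI)
  have [measurable]: "(\<lambda>x. grad f x \<bullet> b) \<in> borel_measurable borel"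
    using smooth_continuous_on[OF smooth_grad_inner[OF f b]] by (rule borel_measurable_continuous_onI)
  have bdd: "bounded (grad f ` K)"
    using K(1) smooth_continuous_on_grad[OF f] compact_continuous_image compact_imp_bounded by blast
  obtain M where M: "M > 0" "\<And>x. norm (grad f x) \<le> M"
  proof -
    assume *: thesis if "0 < M" "\<And>x. norm (grad f x) \<le> M" for M
    obtain M where "0 < M" "\<And>x. x \<in> K \<Longrightarrow> norm (grad f x) \<le> M"
      using bdd unfolding bounded_pos by auto
    then have "norm (grad f x) \<le> M" for x
      using grad0[of x] by (cases "x \<in> K") auto
    then show thesis using * \<open>0 < M\<close> by blast
  qed
  obtain R where R: "\<And>x. x \<in> K \<Longrightarrow> norm x \<le> R"
    using compact_imp_bounded[OF K(1)] unfolding bounded_iff by auto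
  have lip: "\<bar>f y - f x\<bar> \<le> M * norm (y - x)" for x y
  proof -
    have on: "onorm (\<lambda>v. grad f x \<bullet> v) \<le> M" for x
    proof (rule onorm_bound)
      fix v
      have "\<bar>grad f x \<bullet> v\<bar> \<le> norm (grad f x) * norm v"
        by (rule Cauchy_Schwarz_ineq2)
      also have "\<dots> \<le> M * norm v"
        using M(2) by (rule mult_right_mono) simp
      finally show "norm (grad f x \<bullet> v) \<le> M * norm v" by simp
    qed (use M(1) in simp)
    have "norm (f y - f x) \<le> M * norm (y - x)"
      by (rule differentiable_bound[where S = UNIV and f' = "\<lambda>x v. grad f x \<bullet> v"])
        (use smooth_has_derivative[OF f] on in auto)
    then show ?thesis by simp
  qed
  have int0: "(LINT x|lborel. ?q n x) = 0" for n
  proof -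
    have "integrable lborel f"
      using integrable_continuous_compact_support[OF smooth_continuous_on[OF f] K] .
    moreover have "integrable (distr lborel borel ((+) c)) f" for c
      using calculation lborel_distr_plus[of c] by simp
    then have "integrable lborel (\<lambda>x. f (c + x))" for c
      by (simp add: integrable_distr_eq)
    ultimately show ?thesis
      using integral_lborel_translation[of f] by simp
  qed
  have "(\<lambda>n. LINT x|lborel. ?q n x) \<longlonglongrightarrow> (LINT x|lborel. grad f x \<bullet> b)"
  proof (rule integral_dominated_convergence)
    \<comment> \<open>The shift has length at most 1, so every difference quotient vanishes outside
      the ball of radius \<open>R + 1\<close>; inside, the Lipschitz constant \<open>M\<close>
      bounds it.\<close>
    show "integrable lborel (\<lambda>x::'a. indicator (cball 0 (R + 1)) x * M)"
      using borel_integrable_compact[of "cball (0::'a) (R + 1)" "\<lambda>_. M"] by simp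
    show "AE x in lborel. (\<lambda>n. ?q n x) \<longlonglongrightarrow> grad f x \<bullet> b"
    proof (rule AE_I2)
      fix x
      have "((\<lambda>t. t *\<^sub>R b + x) has_derivative (\<lambda>t. t *\<^sub>R b)) (at 0)"
        by (auto intro!: derivative_eq_intros)
      from has_derivative_compose[OF this smooth_has_derivative[OF f]]
      have "((\<lambda>t. f (t *\<^sub>R b + x)) has_real_derivative grad f x \<bullet> b) (at 0)"
        unfolding has_field_derivative_def
        by (rule has_derivative_eq_rhs) (auto simp: fun_eq_iff)
      then have "((\<lambda>t. (f (t *\<^sub>R b + x) - f x) / t) \<longlongrightarrow> grad f x \<bullet> b) (at 0)"
        unfolding has_field_derivative_iff by simp
      moreover have "filterlim (\<lambda>n. inverse (real (Suc n))) (at 0) sequentially"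
        using LIMSEQ_inverse_real_of_nat by (auto simp: filterlim_at)
      ultimately show "(\<lambda>n. ?q n x) \<longlonglongrightarrow> grad f x \<bullet> b"
        by (rule filterlim_compose)
    qed
    show "AE x in lborel. norm (?q n x) \<le> indicator (cball 0 (R + 1)) x * M" for n
    proof (rule AE_I2)
      fix x
      let ?t = "inverse (real (Suc n))"
      have t: "0 < ?t" "?t \<le> 1" by (auto simp: inverse_le_1_iff)
      have nb: "norm b = 1" using b by simp
      show "norm (?q n x) \<le> indicator (cball 0 (R + 1)) x * M"
      proof (cases "norm x \<le> R + 1")
        case True
        have "\<bar>f (?t *\<^sub>R b + x) - f x\<bar> \<le> M * ?t"
          using lip[of "?t *\<^sub>R b + x" x] t nb by simp
        then have "\<bar>f (?t *\<^sub>R b + x) - f x\<bar> / ?t \<le> M"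
          using t by (simp add: pos_divide_le_eq)
        then show ?thesis using True t by (simp add: abs_divide)
      next
        case False
        have "norm x \<le> norm (?t *\<^sub>R b + x) + ?t"
          using norm_triangle_ineq4[of "?t *\<^sub>R b + x" "?t *\<^sub>R b"] t nb by simp
        then have "?t *\<^sub>R b + x \<notin> K" "x \<notin> K"
          using R[of x] R[of "?t *\<^sub>R b + x"] False t by auto
        then show ?thesis using K(2) False by simp
      qed
    qed
  qed simp_all
  then show ?thesis
    unfolding int0 by (simp add: LIMSEQ_const_iff)
qed

section \<open>Test functions\<close>

lemma test_function_iff:
  "test_function \<Omega> \<phi> \<longleftrightarrow> smooth \<phi> \<and> (\<exists>K. compact K \<and> K \<subseteq> \<Omega> \<and> (\<forall>x. x \<notin> K \<longrightarrow> \<phi> x = 0))"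
  by (simp add: test_function_def smooth_def)

lemma test_function_smooth: "test_function \<Omega> \<phi> \<Longrightarrow> smooth \<phi>"
  by (simp add: test_function_iff)

lemma test_function_mult:
  "test_function \<Omega> \<phi> \<Longrightarrow> smooth \<eta> \<Longrightarrow> test_function \<Omega> (\<lambda>x. \<phi> x * \<eta> x)"
  unfolding test_function_iff by (auto intro: smooth_mult)

lemma test_function_add:
  assumes "test_function \<Omega> \<phi>" "test_function \<Omega> \<psi>"
  shows "test_function \<Omega> (\<lambda>x. \<phi> x + \<psi> x)"
proof -
  obtain K L where "compact K" "K \<subseteq> \<Omega>" "\<forall>x. x \<notin> K \<longrightarrow> \<phi> x = 0"
    "compact L" "L \<subseteq> \<Omega>" "\<forall>x. x \<notin> L \<longrightarrow> \<psi> x = 0"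
    using assms unfolding test_function_iff by blast
  then have "compact (K \<union> L) \<and> K \<union> L \<subseteq> \<Omega> \<and> (\<forall>x. x \<notin> K \<union> L \<longrightarrow> \<phi> x + \<psi> x = 0)"
    by auto
  then show ?thesis
    using assms unfolding test_function_iff by (blast intro: smooth_add)
qed

lemma test_function_compose:
  "test_function \<Omega> \<phi> \<Longrightarrow> smooth h \<Longrightarrow> h 0 = 0 \<Longrightarrow> test_function \<Omega> (\<lambda>x. h (\<phi> x))"
  unfolding test_function_iff by (metis smooth_compose)

lemma integral_grad_test_function:
  assumes "\<Omega> \<in> sets lebesgue" "test_function \<Omega> \<phi>" "b \<in> Basis"
  shows "(LINT x|lebesgue_on \<Omega>. grad \<phi> x \<bullet> b) = 0"
proof -
  obtain K where K: "compact K" "K \<subseteq> \<Omega>" "\<forall>x. x \<notin> K \<longrightarrow> \<phi> x = 0" and s: "smooth \<phi>"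
    using assms(2) unfolding test_function_iff by blast
  have "(LINT x|lebesgue_on \<Omega>. grad \<phi> x \<bullet> b) = (LINT x|lborel. grad \<phi> x \<bullet> b)"
  proof (rule integral_lebesgue_on_eq_lborel[OF assms(1)])
    show "(\<lambda>x. grad \<phi> x \<bullet> b) \<in> borel_measurable borel"
      using smooth_continuous_on[OF smooth_grad_inner[OF s assms(3)]]
      by (rule borel_measurable_continuous_onI)
    show "grad \<phi> x \<bullet> b = 0" if "x \<notin> \<Omega>" for x
      using grad_eq_0_outside_support[OF K(1,3)] K(2) that by (metis inner_zero_left subsetD)
  qed
  then show ?thesis
    using integral_grad_eq_0[OF s K(1,3) assms(3)] by simp
qed

section \<open>Square-integrable functions and weak gradients\<close>

lemma norm_add_square_le: "(norm (x + y))\<^sup>2 \<le> 2 * (norm x)\<^sup>2 + 2 * (norm y)\<^sup>2"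
  for x y :: "'b::real_normed_vector"
proof -
  have "(norm (x + y))\<^sup>2 \<le> (norm x + norm y)\<^sup>2"
    by (intro power_mono norm_triangle_ineq) simp
  then show ?thesis
    using sum_squares_bound[of "norm x" "norm y"] by (simp add: power2_sum)
qed

lemma integrable_lebesgue_on_bound:
  fixes g :: "'a::euclidean_space \<Rightarrow> real"
  assumes "integrable (lebesgue_on \<Omega>) h" "g \<in> borel_measurable (lebesgue_on \<Omega>)"
    and "\<And>x. x \<in> \<Omega> \<Longrightarrow> \<bar>g x\<bar> \<le> h x"
  shows "integrable (lebesgue_on \<Omega>) g"
proof (rule Bochner_Integration.integrable_bound[OF assms(1,2)])
  show "AE x in lebesgue_on \<Omega>. norm (g x) \<le> norm (h x)"
  proof (rule AE_I2)
    fix x assume "x \<in> space (lebesgue_on \<Omega>)"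
    then have "\<bar>g x\<bar> \<le> h x" by (intro assms(3)) simp
    then show "norm (g x) \<le> norm (h x)" by simp
  qed
qed

lemma square_integrable_on_bound:
  fixes f :: "'a::euclidean_space \<Rightarrow> 'b::euclidean_space" and g :: "'a \<Rightarrow> 'c::euclidean_space"
  assumes "square_integrable_on \<Omega> f" "g \<in> borel_measurable (lebesgue_on \<Omega>)"
    and "\<And>x. x \<in> \<Omega> \<Longrightarrow> norm (g x) \<le> B * norm (f x)"
  shows "square_integrable_on \<Omega> g"
  unfolding square_integrable_on_def
proof
  have [measurable]: "g \<in> borel_measurable (lebesgue_on \<Omega>)" by fact
  show "integrable (lebesgue_on \<Omega>) (\<lambda>x. (norm (g x))\<^sup>2)"
  proof (rule integrable_lebesgue_on_bound)
    show "integrable (lebesgue_on \<Omega>) (\<lambda>x. B\<^sup>2 * (norm (f x))\<^sup>2)"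
      using assms(1) by (simp add: square_integrable_on_def)
    show "\<bar>(norm (g x))\<^sup>2\<bar> \<le> B\<^sup>2 * (norm (f x))\<^sup>2" if "x \<in> \<Omega>" for x
      using power_mono[OF assms(3)[OF that], of 2] by (simp add: power_mult_distrib)
  qed measurable
qed (fact assms)

lemma square_integrable_on_add:
  fixes f g :: "'a::euclidean_space \<Rightarrow> 'b::euclidean_space"
  assumes "square_integrable_on \<Omega> f" "square_integrable_on \<Omega> g"
  shows "square_integrable_on \<Omega> (\<lambda>x. f x + g x)"
  unfolding square_integrable_on_def
proof
  have [measurable]: "f \<in> borel_measurable (lebesgue_on \<Omega>)" "g \<in> borel_measurable (lebesgue_on \<Omega>)"
    using assms by (auto simp: square_integrable_on_def)
  show "(\<lambda>x. f x + g x) \<in> borel_measurable (lebesgue_on \<Omega>)" by measurable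
  show "integrable (lebesgue_on \<Omega>) (\<lambda>x. (norm (f x + g x))\<^sup>2)"
  proof (rule integrable_lebesgue_on_bound)
    show "integrable (lebesgue_on \<Omega>) (\<lambda>x. 2 * (norm (f x))\<^sup>2 + 2 * (norm (g x))\<^sup>2)"
      using assms by (simp add: square_integrable_on_def)
    show "\<bar>(norm (f x + g x))\<^sup>2\<bar> \<le> 2 * (norm (f x))\<^sup>2 + 2 * (norm (g x))\<^sup>2" for x
      using norm_add_square_le[of "f x" "g x"] by simp
  qed measurable
qed

lemma square_integrable_on_scaleR:
  fixes f :: "'a::euclidean_space \<Rightarrow> 'b::euclidean_space"
  assumes "square_integrable_on \<Omega> f"
  shows "square_integrable_on \<Omega> (\<lambda>x. c *\<^sub>R f x)"
  using assms by (auto simp: square_integrable_on_def power_mult_distrib)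

lemma square_integrable_on_diff:
  fixes f g :: "'a::euclidean_space \<Rightarrow> 'b::euclidean_space"
  assumes "square_integrable_on \<Omega> f" "square_integrable_on \<Omega> g"
  shows "square_integrable_on \<Omega> (\<lambda>x. f x - g x)"
  using square_integrable_on_add[OF assms(1) square_integrable_on_scaleR[OF assms(2), of "- 1"]]
  by simp

lemma integrable_inner_square_integrable:
  fixes f g :: "'a::euclidean_space \<Rightarrow> 'b::euclidean_space"
  assumes "square_integrable_on \<Omega> f" "square_integrable_on \<Omega> g"
  shows "integrable (lebesgue_on \<Omega>) (\<lambda>x. f x \<bullet> g x)"
proof (rule integrable_lebesgue_on_bound)
  have [measurable]: "f \<in> borel_measurable (lebesgue_on \<Omega>)" "g \<in> borel_measurable (lebesgue_on \<Omega>)"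
    using assms by (auto simp: square_integrable_on_def)
  show "(\<lambda>x. f x \<bullet> g x) \<in> borel_measurable (lebesgue_on \<Omega>)" by measurable
  show "integrable (lebesgue_on \<Omega>) (\<lambda>x. (norm (f x))\<^sup>2 + (norm (g x))\<^sup>2)"
    using assms by (simp add: square_integrable_on_def)
  show "\<bar>f x \<bullet> g x\<bar> \<le> (norm (f x))\<^sup>2 + (norm (g x))\<^sup>2" for x
    using Cauchy_Schwarz_ineq2[of "f x" "g x"] sum_squares_bound[of "norm (f x)" "norm (g x)"]
      zero_le_power2[of "norm (f x)"] zero_le_power2[of "norm (g x)"] by linarith
qed

lemma integrable_mult_square_integrable:
  fixes f g :: "'a::euclidean_space \<Rightarrow> real"
  assumes "square_integrable_on \<Omega> f" "square_integrable_on \<Omega> g"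
  shows "integrable (lebesgue_on \<Omega>) (\<lambda>x. f x * g x)"
  using integrable_inner_square_integrable[OF assms] by simp

lemma square_integrable_on_norm:
  "square_integrable_on \<Omega> f \<Longrightarrow> square_integrable_on \<Omega> (\<lambda>x. norm (f x))"
  by (auto simp: square_integrable_on_def)

text \<open>Young's inequality with a weight, from the square of
  \<open>\<epsilon> * f x - g x\<close>; a factor 1 / 2 is given away. Its use is to let
  \<open>g\<close> tend to 0 in \<open>L\<^sup>2\<close> for fixed \<epsilon> and to shrink
  \<epsilon> afterwards.\<close>

lemma integral_mult_le_weighted:
  fixes f g :: "'a::euclidean_space \<Rightarrow> real"
  assumes "square_integrable_on \<Omega> f" "square_integrable_on \<Omega> g" "0 < \<epsilon>"
  shows "(LINT x|lebesgue_on \<Omega>. f x * g x)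
    \<le> \<epsilon> * (LINT x|lebesgue_on \<Omega>. (f x)\<^sup>2) + (LINT x|lebesgue_on \<Omega>. (g x)\<^sup>2) / \<epsilon>"
proof -
  have i: "integrable (lebesgue_on \<Omega>) (\<lambda>x. (f x)\<^sup>2)" "integrable (lebesgue_on \<Omega>) (\<lambda>x. (g x)\<^sup>2)"
    using assms by (auto simp: square_integrable_on_def)
  have "f x * g x \<le> \<epsilon> * (f x)\<^sup>2 + (g x)\<^sup>2 / \<epsilon>" for x
  proof -
    have "0 \<le> (\<epsilon> * f x - g x)\<^sup>2" by simp
    then have "2 * (\<epsilon> * (f x * g x)) \<le> \<epsilon> * (\<epsilon> * (f x)\<^sup>2) + (g x)\<^sup>2"
      by (simp add: power2_diff power_mult_distrib power2_eq_square algebra_simps)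
    moreover have "0 \<le> \<epsilon> * (\<epsilon> * (f x)\<^sup>2)" "0 \<le> (g x)\<^sup>2" using assms(3) by auto
    ultimately have "\<epsilon> * (f x * g x) \<le> \<epsilon> * (\<epsilon> * (f x)\<^sup>2) + (g x)\<^sup>2" by linarith
    then show ?thesis using assms(3) by (simp add: field_simps)
  qed
  then have "(LINT x|lebesgue_on \<Omega>. f x * g x)
      \<le> (LINT x|lebesgue_on \<Omega>. \<epsilon> * (f x)\<^sup>2 + (g x)\<^sup>2 / \<epsilon>)"
    using integrable_mult_square_integrable[OF assms(1,2)] i by (intro integral_mono) auto
  then show ?thesis using i by simp
qed

lemma L2_norm_on_square: "(L2_norm_on \<Omega> f)\<^sup>2 = (LINT x|lebesgue_on \<Omega>. (norm (f x))\<^sup>2)"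
  unfolding L2_norm_on_def by (intro real_sqrt_pow2 integral_nonneg_AE) auto

lemma L2_norm_on_tendsto_0_iff:
  "((\<lambda>i. L2_norm_on \<Omega> (f i)) \<longlongrightarrow> 0) F \<longleftrightarrow>
   ((\<lambda>i. LINT x|lebesgue_on \<Omega>. (norm (f i x))\<^sup>2) \<longlongrightarrow> 0) F"
proof
  assume "((\<lambda>i. L2_norm_on \<Omega> (f i)) \<longlongrightarrow> 0) F"
  from tendsto_power[OF this, of 2]
  show "((\<lambda>i. LINT x|lebesgue_on \<Omega>. (norm (f i x))\<^sup>2) \<longlongrightarrow> 0) F"
    by (simp add: L2_norm_on_square)
next
  assume "((\<lambda>i. LINT x|lebesgue_on \<Omega>. (norm (f i x))\<^sup>2) \<longlongrightarrow> 0) F"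
  from tendsto_real_sqrt[OF this]
  show "((\<lambda>i. L2_norm_on \<Omega> (f i)) \<longlongrightarrow> 0) F"
    by (simp add: L2_norm_on_def)
qed

text \<open>Serves both closure properties of \<open>H10\<close>: for products the gradient error
  mixes the errors of functions and of gradients, for sums it mixes the errors of two
  sequences.\<close>

lemma L2_norm_on_combination_tendsto_0:
  fixes f :: "'i \<Rightarrow> 'a::euclidean_space \<Rightarrow> 'b::euclidean_space"
    and g :: "'i \<Rightarrow> 'a::euclidean_space \<Rightarrow> 'c::euclidean_space"
    and h :: "'i \<Rightarrow> 'a::euclidean_space \<Rightarrow> 'd::euclidean_space"
  assumes "((\<lambda>i. L2_norm_on \<Omega> (f i)) \<longlongrightarrow> 0) F" "((\<lambda>i. L2_norm_on \<Omega> (g i)) \<longlongrightarrow> 0) F"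
    and "\<forall>\<^sub>F i in F. square_integrable_on \<Omega> (f i)" "\<forall>\<^sub>F i in F. square_integrable_on \<Omega> (g i)"
    and "\<And>i x. x \<in> \<Omega> \<Longrightarrow> norm (h i x) \<le> B * norm (f i x) + B * norm (g i x)"
  shows "((\<lambda>i. L2_norm_on \<Omega> (h i)) \<longlongrightarrow> 0) F"
  unfolding L2_norm_on_tendsto_0_iff
proof (rule tendsto_sandwich[OF _ _ tendsto_const])
  show "\<forall>\<^sub>F i in F. 0 \<le> (LINT x|lebesgue_on \<Omega>. (norm (h i x))\<^sup>2)"
    by (intro always_eventually allI integral_nonneg_AE) auto
  have "((\<lambda>i. 2 * B\<^sup>2 * (LINT x|lebesgue_on \<Omega>. (norm (f i x))\<^sup>2)
        + 2 * B\<^sup>2 * (LINT x|lebesgue_on \<Omega>. (norm (g i x))\<^sup>2))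
      \<longlongrightarrow> 2 * B\<^sup>2 * 0 + 2 * B\<^sup>2 * 0) F"
    using assms(1,2) unfolding L2_norm_on_tendsto_0_iff by (intro tendsto_intros)
  then show "((\<lambda>i. 2 * B\<^sup>2 * (LINT x|lebesgue_on \<Omega>. (norm (f i x))\<^sup>2)
        + 2 * B\<^sup>2 * (LINT x|lebesgue_on \<Omega>. (norm (g i x))\<^sup>2)) \<longlongrightarrow> 0) F"
    by simp
  show "\<forall>\<^sub>F i in F. (LINT x|lebesgue_on \<Omega>. (norm (h i x))\<^sup>2)
      \<le> 2 * B\<^sup>2 * (LINT x|lebesgue_on \<Omega>. (norm (f i x))\<^sup>2)
        + 2 * B\<^sup>2 * (LINT x|lebesgue_on \<Omega>. (norm (g i x))\<^sup>2)"
    using assms(3,4)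
  proof eventually_elim
    case (elim i)
    have i: "integrable (lebesgue_on \<Omega>) (\<lambda>x. (norm (f i x))\<^sup>2)"
      "integrable (lebesgue_on \<Omega>) (\<lambda>x. (norm (g i x))\<^sup>2)"
      using elim by (auto simp: square_integrable_on_def)
    have "(norm (h i x))\<^sup>2 \<le> 2 * B\<^sup>2 * (norm (f i x))\<^sup>2 + 2 * B\<^sup>2 * (norm (g i x))\<^sup>2"
      if "x \<in> \<Omega>" for x
    proof -
      have "(norm (h i x))\<^sup>2 \<le> (B * norm (f i x) + B * norm (g i x))\<^sup>2"
        using assms(5)[OF that] by (intro power_mono) auto
      also have "\<dots> \<le> 2 * (B * norm (f i x))\<^sup>2 + 2 * (B * norm (g i x))\<^sup>2"
        using norm_add_square_le[of "B * norm (f i x)" "B * norm (g i x)"] by simp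
      finally show ?thesis by (simp add: power_mult_distrib algebra_simps)
    qed
    \<comment> \<open>If the left integrand fails to be integrable, its integral is the default
      value 0, which the nonnegative right side still dominates.\<close>
    then have "(LINT x|lebesgue_on \<Omega>. (norm (h i x))\<^sup>2)
        \<le> (LINT x|lebesgue_on \<Omega>. 2 * B\<^sup>2 * (norm (f i x))\<^sup>2 + 2 * B\<^sup>2 * (norm (g i x))\<^sup>2)"
      using i by (intro integral_mono_AE') (auto intro!: AE_I2)
    then show ?case using i by simp
  qed
qed

section \<open>Weak gradients\<close>

lemma tendsto_H1I:
  assumes "\<forall>\<^sub>F i in F. has_weak_gradient \<Omega> (f i) (Df i)" "has_weak_gradient \<Omega> u Du"
    and "((\<lambda>i. L2_norm_on \<Omega> (\<lambda>x. f i x - u x)) \<longlongrightarrow> 0) F"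
    and "((\<lambda>i. L2_norm_on \<Omega> (\<lambda>x. Df i x - Du x)) \<longlongrightarrow> 0) F"
  shows "tendsto_H1 \<Omega> f u F"
  unfolding tendsto_H1_def using assms by (intro exI conjI)

lemma has_weak_gradientD:
  assumes "has_weak_gradient \<Omega> u G"
  shows "square_integrable_on \<Omega> u" "square_integrable_on \<Omega> G"
    and "test_function \<Omega> \<phi> \<Longrightarrow> b \<in> Basis \<Longrightarrow>
      (LINT x|lebesgue_on \<Omega>. u x * (grad \<phi> x \<bullet> b)) = - (LINT x|lebesgue_on \<Omega>. (G x \<bullet> b) * \<phi> x)"
  using assms unfolding has_weak_gradient_def by (auto simp: grad_inner)

lemma has_weak_gradientI:
  assumes "square_integrable_on \<Omega> u" "square_integrable_on \<Omega> G"
    and "\<And>\<phi> b. test_function \<Omega> \<phi> \<Longrightarrow> b \<in> Basis \<Longrightarrow>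
      (LINT x|lebesgue_on \<Omega>. u x * (grad \<phi> x \<bullet> b)) = - (LINT x|lebesgue_on \<Omega>. (G x \<bullet> b) * \<phi> x)"
  shows "has_weak_gradient \<Omega> u G"
  using assms unfolding has_weak_gradient_def by (auto simp: grad_inner)

text \<open>The positive and negative parts of the competitor are identified only inside \<Omega>;
  this lets them inherit the weak gradients of explicit products.\<close>

lemma has_weak_gradient_cong:
  assumes "\<And>x. x \<in> \<Omega> \<Longrightarrow> u x = v x" "has_weak_gradient \<Omega> u G"
  shows "has_weak_gradient \<Omega> v G"
proof (rule has_weak_gradientI)
  show "square_integrable_on \<Omega> v"
  proof (rule square_integrable_on_bound[where B = 1])
    show "square_integrable_on \<Omega> u" using has_weak_gradientD(1)[OF assms(2)] .
    then show "v \<in> borel_measurable (lebesgue_on \<Omega>)"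
      using assms(1) measurable_cong[of "lebesgue_on \<Omega>" u v borel]
      by (auto simp: square_integrable_on_def)
  qed (use assms(1) in auto)
  show "(LINT x|lebesgue_on \<Omega>. v x * (grad \<phi> x \<bullet> b)) = - (LINT x|lebesgue_on \<Omega>. (G x \<bullet> b) * \<phi> x)"
    if "test_function \<Omega> \<phi>" "b \<in> Basis" for \<phi> b
    using has_weak_gradientD(3)[OF assms(2) that] assms(1)
    by (metis (mono_tags, lifting) Bochner_Integration.integral_cong space_lebesgue_on)
qed (use has_weak_gradientD(2)[OF assms(2)] in simp)

section \<open>Sobolev functions on a bounded open set\<close>

context
  fixes \<Omega> :: "'a::euclidean_space set"
  assumes open_dom: "open \<Omega>" and bounded_dom: "bounded \<Omega>"
begin

lemma dom_sets: "\<Omega> \<in> sets lebesgue"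
  by (simp add: borel_open open_dom sets_completionI_sets)

lemma finite_measure_dom: "finite_measure (lebesgue_on \<Omega>)"
  using fmeasurableD2[OF bounded_set_imp_lmeasurable[OF bounded_dom dom_sets]]
  by (intro finite_measureI) (simp add: emeasure_restrict_space dom_sets)

lemma bounded_on_dom:
  fixes f :: "'a \<Rightarrow> 'b::real_normed_vector"
  assumes "continuous_on UNIV f"
  shows "\<exists>B>0. \<forall>x\<in>\<Omega>. norm (f x) \<le> B"
proof -
  have "compact (f ` closure \<Omega>)"
    using bounded_dom continuous_on_subset[OF assms]
    by (intro compact_continuous_image) (auto simp: compact_closure)
  then have "bounded (f ` closure \<Omega>)" by (rule compact_imp_bounded)
  then obtain B where B: "0 < B" "\<And>y. y \<in> f ` closure \<Omega> \<Longrightarrow> norm y \<le> B"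
    unfolding bounded_pos by auto
  have "norm (f x) \<le> B" if "x \<in> \<Omega>" for x
    using B(2)[of "f x"] that closure_subset[of \<Omega>] by auto
  with B(1) show ?thesis by blast
qed

lemma continuous_measurable_on_dom:
  fixes f :: "'a \<Rightarrow> 'b::euclidean_space"
  shows "continuous_on UNIV f \<Longrightarrow> f \<in> borel_measurable (lebesgue_on \<Omega>)"
  using continuous_imp_measurable_on_sets_lebesgue[OF continuous_on_subset dom_sets] by blast

lemma square_integrable_on_mult_continuous:
  fixes \<eta> :: "'a \<Rightarrow> real" and f :: "'a \<Rightarrow> 'b::euclidean_space"
  assumes "square_integrable_on \<Omega> f" "continuous_on UNIV \<eta>"
  shows "square_integrable_on \<Omega> (\<lambda>x. \<eta> x *\<^sub>R f x)"
proof -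
  obtain B where "0 < B" "\<And>x. x \<in> \<Omega> \<Longrightarrow> norm (\<eta> x) \<le> B"
    using bounded_on_dom[OF assms(2)] by blast
  then show ?thesis
    using assms continuous_measurable_on_dom[OF assms(2)]
    by (intro square_integrable_on_bound[OF assms(1), where B = B])
      (auto simp: square_integrable_on_def intro!: mult_right_mono)
qed

lemma square_integrable_on_scaleR_continuous:
  fixes f :: "'a \<Rightarrow> real" and V :: "'a \<Rightarrow> 'b::euclidean_space"
  assumes "square_integrable_on \<Omega> f" "continuous_on UNIV V"
  shows "square_integrable_on \<Omega> (\<lambda>x. f x *\<^sub>R V x)"
proof -
  obtain B where "0 < B" "\<And>x. x \<in> \<Omega> \<Longrightarrow> norm (V x) \<le> B"
    using bounded_on_dom[OF assms(2)] by blast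
  then show ?thesis
    using assms continuous_measurable_on_dom[OF assms(2)]
    by (intro square_integrable_on_bound[OF assms(1), where B = B])
      (auto simp: square_integrable_on_def mult.commute[of B] intro!: mult_left_mono)
qed

lemma square_integrable_on_const:
  fixes c :: "'b::euclidean_space"
  shows "square_integrable_on \<Omega> (\<lambda>_. c)"
  using finite_measure_dom unfolding square_integrable_on_def
  by (auto intro: finite_measure.integrable_const)

lemma square_integrable_on_continuous:
  fixes f :: "'a \<Rightarrow> 'b::euclidean_space"
  assumes "continuous_on UNIV f"
  shows "square_integrable_on \<Omega> f"
  using square_integrable_on_scaleR_continuous[OF square_integrable_on_const[of "1::real"] assms]
  by simp

text \<open>Use \<open>\<phi> x * \<eta> x\<close> as test function for \<open>u\<close>: then
  \<open>\<eta>\<close> times the gradient of \<open>\<phi>\<close> is the gradient of the product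
  minus \<open>\<phi>\<close> times the gradient of \<open>\<eta>\<close>, and the last term moves
  to the weak gradient.\<close>

lemma has_weak_gradient_mult:
  assumes u: "has_weak_gradient \<Omega> u G" and \<eta>: "smooth \<eta>"
  shows "has_weak_gradient \<Omega> (\<lambda>x. u x * \<eta> x) (\<lambda>x. \<eta> x *\<^sub>R G x + u x *\<^sub>R grad \<eta> x)"
proof (rule has_weak_gradientI)
  note U = has_weak_gradientD[OF u]
  note c = smooth_continuous_on[OF \<eta>, of UNIV] smooth_continuous_on_grad[OF \<eta>, of UNIV]
  show "square_integrable_on \<Omega> (\<lambda>x. u x * \<eta> x)"
    using square_integrable_on_mult_continuous[OF U(1) c(1)] by (simp add: mult.commute)
  show "square_integrable_on \<Omega> (\<lambda>x. \<eta> x *\<^sub>R G x + u x *\<^sub>R grad \<eta> x)"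
    using U c by (intro square_integrable_on_add square_integrable_on_mult_continuous
        square_integrable_on_scaleR_continuous)
  fix \<phi> :: "'a \<Rightarrow> real" and b :: 'a
  assume \<phi>: "test_function \<Omega> \<phi>" and b: "b \<in> Basis"
  have s: "smooth \<phi>" using \<phi> by (rule test_function_smooth)
  note c' = smooth_continuous_on[OF s, of UNIV] smooth_continuous_on_grad[OF s, of UNIV]
  have i1: "integrable (lebesgue_on \<Omega>) (\<lambda>x. u x * (grad (\<lambda>x. \<phi> x * \<eta> x) x \<bullet> b))"
    using smooth_continuous_on_grad[OF smooth_mult[OF s \<eta>], of UNIV]
    by (intro integrable_mult_square_integrable U square_integrable_on_continuous continuous_intros)
  have i2: "integrable (lebesgue_on \<Omega>) (\<lambda>x. u x * (\<phi> x * (grad \<eta> x \<bullet> b)))"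
    using c c'
    by (intro integrable_mult_square_integrable U square_integrable_on_continuous continuous_intros)
  have i3: "integrable (lebesgue_on \<Omega>) (\<lambda>x. G x \<bullet> ((\<phi> x * \<eta> x) *\<^sub>R b))"
    using c c'
    by (intro integrable_inner_square_integrable U square_integrable_on_continuous continuous_intros)
  have "(LINT x|lebesgue_on \<Omega>. u x * \<eta> x * (grad \<phi> x \<bullet> b)) =
      (LINT x|lebesgue_on \<Omega>. u x * (grad (\<lambda>x. \<phi> x * \<eta> x) x \<bullet> b) - u x * (\<phi> x * (grad \<eta> x \<bullet> b)))"
    unfolding grad_mult[OF s \<eta>] by (simp add: inner_add_left algebra_simps)
  also have "\<dots> = (LINT x|lebesgue_on \<Omega>. u x * (grad (\<lambda>x. \<phi> x * \<eta> x) x \<bullet> b))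
      - (LINT x|lebesgue_on \<Omega>. u x * (\<phi> x * (grad \<eta> x \<bullet> b)))"
    using i1 i2 by (rule Bochner_Integration.integral_diff)
  also have "(LINT x|lebesgue_on \<Omega>. u x * (grad (\<lambda>x. \<phi> x * \<eta> x) x \<bullet> b))
      = - (LINT x|lebesgue_on \<Omega>. (G x \<bullet> b) * (\<phi> x * \<eta> x))"
    by (rule U(3)[OF test_function_mult[OF \<phi> \<eta>] b])
  also have "- (LINT x|lebesgue_on \<Omega>. (G x \<bullet> b) * (\<phi> x * \<eta> x))
        - (LINT x|lebesgue_on \<Omega>. u x * (\<phi> x * (grad \<eta> x \<bullet> b)))
      = - (LINT x|lebesgue_on \<Omega>. (G x \<bullet> b) * (\<phi> x * \<eta> x) + u x * (\<phi> x * (grad \<eta> x \<bullet> b)))"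
    using i2 i3 by (subst Bochner_Integration.integral_add) (auto simp: mult.commute)
  also have "\<dots> = - (LINT x|lebesgue_on \<Omega>. ((\<eta> x *\<^sub>R G x + u x *\<^sub>R grad \<eta> x) \<bullet> b) * \<phi> x)"
    by (simp add: inner_add_left algebra_simps)
  finally show "(LINT x|lebesgue_on \<Omega>. u x * \<eta> x * (grad \<phi> x \<bullet> b))
    = - (LINT x|lebesgue_on \<Omega>. ((\<eta> x *\<^sub>R G x + u x *\<^sub>R grad \<eta> x) \<bullet> b) * \<phi> x)" .
qed

lemma has_weak_gradient_add:
  assumes u: "has_weak_gradient \<Omega> u G" and v: "has_weak_gradient \<Omega> v H"
  shows "has_weak_gradient \<Omega> (\<lambda>x. u x + v x) (\<lambda>x. G x + H x)"
proof (rule has_weak_gradientI)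
  note U = has_weak_gradientD[OF u] and V = has_weak_gradientD[OF v]
  show "square_integrable_on \<Omega> (\<lambda>x. u x + v x)" "square_integrable_on \<Omega> (\<lambda>x. G x + H x)"
    using U V by (auto intro: square_integrable_on_add)
  fix \<phi> :: "'a \<Rightarrow> real" and b :: 'a
  assume \<phi>: "test_function \<Omega> \<phi>" and b: "b \<in> Basis"
  have s: "smooth \<phi>" using \<phi> by (rule test_function_smooth)
  note c' = smooth_continuous_on[OF s, of UNIV] smooth_continuous_on_grad[OF s, of UNIV]
  have i: "integrable (lebesgue_on \<Omega>) (\<lambda>x. f x * (grad \<phi> x \<bullet> b))"
    if "square_integrable_on \<Omega> f" for f
    using c'
    by (intro integrable_mult_square_integrable that square_integrable_on_continuous continuous_intros)
  have j: "integrable (lebesgue_on \<Omega>) (\<lambda>x. (F x \<bullet> b) * \<phi> x)"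
    if "square_integrable_on \<Omega> F" for F
  proof -
    have "integrable (lebesgue_on \<Omega>) (\<lambda>x. F x \<bullet> (\<phi> x *\<^sub>R b))"
      using c'
      by (intro integrable_inner_square_integrable that square_integrable_on_continuous continuous_intros)
    then show ?thesis by (simp add: mult.commute)
  qed
  show "(LINT x|lebesgue_on \<Omega>. (u x + v x) * (grad \<phi> x \<bullet> b))
      = - (LINT x|lebesgue_on \<Omega>. ((G x + H x) \<bullet> b) * \<phi> x)"
    using U(3)[OF \<phi> b] V(3)[OF \<phi> b] i[OF U(1)] i[OF V(1)] j[OF U(2)] j[OF V(2)]
    by (simp add: distrib_right inner_add_left)
qed

text \<open>Integrate the product rule: the gradient of a product of two test functions has integral
  zero.\<close>

lemma has_weak_gradient_test_function:
  assumes "test_function \<Omega> \<phi>"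
  shows "has_weak_gradient \<Omega> \<phi> (grad \<phi>)"
proof (rule has_weak_gradientI)
  have s: "smooth \<phi>" using assms by (rule test_function_smooth)
  note c = smooth_continuous_on[OF s, of UNIV] smooth_continuous_on_grad[OF s, of UNIV]
  then show "square_integrable_on \<Omega> \<phi>" "square_integrable_on \<Omega> (grad \<phi>)"
    by (auto intro: square_integrable_on_continuous)
  fix \<psi> :: "'a \<Rightarrow> real" and b :: 'a
  assume \<psi>: "test_function \<Omega> \<psi>" and b: "b \<in> Basis"
  have s': "smooth \<psi>" using \<psi> by (rule test_function_smooth)
  note c' = smooth_continuous_on[OF s', of UNIV] smooth_continuous_on_grad[OF s', of UNIV]
  have "integrable (lebesgue_on \<Omega>) (\<lambda>x. \<phi> x * (grad \<psi> x \<bullet> b))"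
    using c c' by (intro integrable_mult_square_integrable square_integrable_on_continuous continuous_intros)
  moreover have "integrable (lebesgue_on \<Omega>) (\<lambda>x. \<psi> x * (grad \<phi> x \<bullet> b))"
    using c c' by (intro integrable_mult_square_integrable square_integrable_on_continuous continuous_intros)
  moreover have "(LINT x|lebesgue_on \<Omega>. grad (\<lambda>x. \<phi> x * \<psi> x) x \<bullet> b) = 0"
    using integral_grad_test_function[OF dom_sets test_function_mult[OF assms s'] b] .
  ultimately show "(LINT x|lebesgue_on \<Omega>. \<phi> x * (grad \<psi> x \<bullet> b))
      = - (LINT x|lebesgue_on \<Omega>. (grad \<phi> x \<bullet> b) * \<psi> x)"
    by (simp add: grad_mult[OF s s'] inner_add_left mult.commute)
qed

lemma test_function_in_H10:
  assumes "test_function \<Omega> \<phi>"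
  shows "\<phi> \<in> H10 \<Omega>"
  unfolding H10_def tendsto_H1_def
  using assms has_weak_gradient_test_function[OF assms]
  by (auto intro!: exI[of _ "\<lambda>_. \<phi>"] exI[of _ "\<lambda>_. grad \<phi>"] exI[of _ "grad \<phi>"] simp: L2_norm_on_def)

text \<open>Multiply the approximating test functions by \<open>\<eta>\<close>. On the bounded set
  \<Omega> both \<open>\<eta>\<close> and its gradient are bounded, so the convergence
  survives.\<close>

lemma H10_mult:
  assumes "u \<in> H10 \<Omega>" and \<eta>: "smooth \<eta>"
  shows "(\<lambda>x. u x * \<eta> x) \<in> H10 \<Omega>"
proof -
  obtain \<phi> D G where \<phi>: "\<And>n::nat. test_function \<Omega> (\<phi> n)"
    and D: "\<forall>\<^sub>F n in sequentially. has_weak_gradient \<Omega> (\<phi> n) (D n)"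
    and G: "has_weak_gradient \<Omega> u G"
    and lim: "(\<lambda>n. L2_norm_on \<Omega> (\<lambda>x. \<phi> n x - u x)) \<longlonglongrightarrow> 0"
      "(\<lambda>n. L2_norm_on \<Omega> (\<lambda>x. D n x - G x)) \<longlonglongrightarrow> 0"
    using assms(1) unfolding H10_def tendsto_H1_def by blast
  obtain B where B: "0 < B" "\<And>x. x \<in> \<Omega> \<Longrightarrow> norm (\<eta> x) \<le> B"
    using bounded_on_dom[OF smooth_continuous_on[OF \<eta>]] by blast
  obtain C where C: "0 < C" "\<And>x. x \<in> \<Omega> \<Longrightarrow> norm (grad \<eta> x) \<le> C"
    using bounded_on_dom[OF smooth_continuous_on_grad[OF \<eta>]] by blast
  have q1: "\<forall>\<^sub>F n in sequentially. square_integrable_on \<Omega> (\<lambda>x. \<phi> n x - u x)"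
    using D G by (auto elim!: eventually_mono intro: square_integrable_on_diff has_weak_gradientD)
  have q2: "\<forall>\<^sub>F n in sequentially. square_integrable_on \<Omega> (\<lambda>x. D n x - G x)"
    using D G by (auto elim!: eventually_mono intro: square_integrable_on_diff has_weak_gradientD)
  have "(\<lambda>n. L2_norm_on \<Omega> (\<lambda>x. \<phi> n x * \<eta> x - u x * \<eta> x)) \<longlonglongrightarrow> 0"
  \<comment> \<open>Only one sequence of errors occurs here, so it fills both slots.\<close>
  proof (rule L2_norm_on_combination_tendsto_0[OF lim(1) lim(1) q1 q1, where B = B])
    fix n x assume "x \<in> \<Omega>"
    have "\<bar>\<phi> n x * \<eta> x - u x * \<eta> x\<bar> = \<bar>\<eta> x\<bar> * \<bar>\<phi> n x - u x\<bar>"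
      by (simp add: left_diff_distrib[symmetric] abs_mult)
    also have "\<dots> \<le> B * \<bar>\<phi> n x - u x\<bar>"
      using B(2)[OF \<open>x \<in> \<Omega>\<close>] by (intro mult_right_mono) auto
    finally show "norm (\<phi> n x * \<eta> x - u x * \<eta> x) \<le> B * norm (\<phi> n x - u x) + B * norm (\<phi> n x - u x)"
      using B(1) mult_nonneg_nonneg[of B "\<bar>\<phi> n x - u x\<bar>"] by simp
  qed
  moreover have "(\<lambda>n. L2_norm_on \<Omega> (\<lambda>x. (\<eta> x *\<^sub>R D n x + \<phi> n x *\<^sub>R grad \<eta> x)
      - (\<eta> x *\<^sub>R G x + u x *\<^sub>R grad \<eta> x))) \<longlonglongrightarrow> 0"
  proof (rule L2_norm_on_combination_tendsto_0[OF lim q1 q2, where B = "B + C"])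
    fix n x assume x: "x \<in> \<Omega>"
    have "norm ((\<eta> x *\<^sub>R D n x + \<phi> n x *\<^sub>R grad \<eta> x) - (\<eta> x *\<^sub>R G x + u x *\<^sub>R grad \<eta> x))
        = norm (\<eta> x *\<^sub>R (D n x - G x) + (\<phi> n x - u x) *\<^sub>R grad \<eta> x)"
      by (simp add: algebra_simps)
    also have "\<dots> \<le> \<bar>\<eta> x\<bar> * norm (D n x - G x) + \<bar>\<phi> n x - u x\<bar> * norm (grad \<eta> x)"
      using norm_triangle_ineq by (metis norm_scaleR)
    also have "\<dots> \<le> (B + C) * norm (D n x - G x) + \<bar>\<phi> n x - u x\<bar> * (B + C)"
      using B(1) B(2)[OF x] C(1) C(2)[OF x] by (intro add_mono mult_mono) auto
    finally show "norm ((\<eta> x *\<^sub>R D n x + \<phi> n x *\<^sub>R grad \<eta> x) - (\<eta> x *\<^sub>R G x + u x *\<^sub>R grad \<eta> x))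
        \<le> (B + C) * norm (\<phi> n x - u x) + (B + C) * norm (D n x - G x)"
      by (simp add: mult.commute)
  qed
  moreover have "\<forall>\<^sub>F n in sequentially.
      has_weak_gradient \<Omega> (\<lambda>x. \<phi> n x * \<eta> x) (\<lambda>x. \<eta> x *\<^sub>R D n x + \<phi> n x *\<^sub>R grad \<eta> x)"
    using D by (rule eventually_mono) (rule has_weak_gradient_mult[OF _ \<eta>])
  ultimately have "tendsto_H1 \<Omega> (\<lambda>n x. \<phi> n x * \<eta> x) (\<lambda>x. u x * \<eta> x) sequentially"
    using has_weak_gradient_mult[OF G \<eta>] by (intro tendsto_H1I)
  then show ?thesis
    unfolding H10_def using test_function_mult[OF \<phi> \<eta>]
    by (intro CollectI exI[of _ "\<lambda>n x. \<phi> n x * \<eta> x"]) simp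
qed

lemma H10_add:
  assumes "u \<in> H10 \<Omega>" "v \<in> H10 \<Omega>"
  shows "(\<lambda>x. u x + v x) \<in> H10 \<Omega>"
proof -
  obtain \<phi> D G where \<phi>: "\<And>n::nat. test_function \<Omega> (\<phi> n)"
    and D: "\<forall>\<^sub>F n in sequentially. has_weak_gradient \<Omega> (\<phi> n) (D n)"
    and G: "has_weak_gradient \<Omega> u G"
    and lim: "(\<lambda>n. L2_norm_on \<Omega> (\<lambda>x. \<phi> n x - u x)) \<longlonglongrightarrow> 0"
      "(\<lambda>n. L2_norm_on \<Omega> (\<lambda>x. D n x - G x)) \<longlonglongrightarrow> 0"
    using assms(1) unfolding H10_def tendsto_H1_def by blast
  obtain \<psi> E H where \<psi>: "\<And>n::nat. test_function \<Omega> (\<psi> n)"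
    and E: "\<forall>\<^sub>F n in sequentially. has_weak_gradient \<Omega> (\<psi> n) (E n)"
    and H: "has_weak_gradient \<Omega> v H"
    and lim': "(\<lambda>n. L2_norm_on \<Omega> (\<lambda>x. \<psi> n x - v x)) \<longlonglongrightarrow> 0"
      "(\<lambda>n. L2_norm_on \<Omega> (\<lambda>x. E n x - H x)) \<longlonglongrightarrow> 0"
    using assms(2) unfolding H10_def tendsto_H1_def by blast
  have q: "\<forall>\<^sub>F n in sequentially. square_integrable_on \<Omega> (\<lambda>x. \<phi> n x - u x)"
    "\<forall>\<^sub>F n in sequentially. square_integrable_on \<Omega> (\<lambda>x. D n x - G x)"
    "\<forall>\<^sub>F n in sequentially. square_integrable_on \<Omega> (\<lambda>x. \<psi> n x - v x)"
    "\<forall>\<^sub>F n in sequentially. square_integrable_on \<Omega> (\<lambda>x. E n x - H x)"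
    by (rule eventually_mono[OF D], intro square_integrable_on_diff has_weak_gradientD(1)[OF G],
        erule has_weak_gradientD)
      (rule eventually_mono[OF D], intro square_integrable_on_diff has_weak_gradientD(2)[OF G],
        erule has_weak_gradientD,
        rule eventually_mono[OF E], intro square_integrable_on_diff has_weak_gradientD(1)[OF H],
        erule has_weak_gradientD,
        rule eventually_mono[OF E], intro square_integrable_on_diff has_weak_gradientD(2)[OF H],
        erule has_weak_gradientD)
  have n: "norm (a + b - (c + d)) \<le> 1 * norm (a - c) + 1 * norm (b - d)"
    for a b c d :: "'b::real_normed_vector"
    using norm_diff_triangle_ineq[of a b c d] by simp
  have "(\<lambda>k. L2_norm_on \<Omega> (\<lambda>x. \<phi> k x + \<psi> k x - (u x + v x))) \<longlonglongrightarrow> 0"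
    by (rule L2_norm_on_combination_tendsto_0[OF lim(1) lim'(1) q(1,3)]) (rule n)
  moreover have "(\<lambda>k. L2_norm_on \<Omega> (\<lambda>x. D k x + E k x - (G x + H x))) \<longlonglongrightarrow> 0"
    by (rule L2_norm_on_combination_tendsto_0[OF lim(2) lim'(2) q(2,4)]) (rule n)
  moreover have "\<forall>\<^sub>F k in sequentially.
      has_weak_gradient \<Omega> (\<lambda>x. \<phi> k x + \<psi> k x) (\<lambda>x. D k x + E k x)"
    using D E by eventually_elim (rule has_weak_gradient_add)
  ultimately have "tendsto_H1 \<Omega> (\<lambda>k x. \<phi> k x + \<psi> k x) (\<lambda>x. u x + v x) sequentially"
    using has_weak_gradient_add[OF G H] by (intro tendsto_H1I)
  then show ?thesis
    unfolding H10_def using test_function_add[OF \<phi> \<psi>]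
    by (intro CollectI exI[of _ "\<lambda>n x. \<phi> n x + \<psi> n x"]) simp
qed

end

section \<open>Functions in \<open>H\<^sup>1\<^sub>0\<close> have no positive lower bound\<close>

text \<open>With \<open>h\<close> a smooth step from \<open>0\<close> at \<open>0\<close> to \<open>1\<close> on \<open>[\<tau>, \<infinity>)\<close> and test functions \<open>\<phi> n\<close> tending
  to a function \<open>u \<ge> \<tau>\<close>, the test functions \<open>h (\<phi> n)\<close> tend to \<open>1\<close> and their gradients to \<open>0\<close>;
  integration by parts against a coordinate function shows that \<open>\<Omega>\<close> is null.\<close>

lemma H10_inf_nonpos:
  fixes \<Omega> :: "'a::euclidean_space set"
  assumes dom: "open \<Omega>" "bounded \<Omega>" "\<Omega> \<noteq> {}" and u: "u \<in> H10 \<Omega>" and \<tau>: "0 < \<tau>"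
  shows "\<exists>x\<in>\<Omega>. u x < \<tau>"
proof (rule ccontr)
  assume "\<not> (\<exists>x\<in>\<Omega>. u x < \<tau>)"
  then have u_ge: "\<tau> \<le> u x" if "x \<in> \<Omega>" for x using that by force
  note sq_cont = square_integrable_on_continuous[OF dom(1,2)]
  obtain \<phi> D G where \<phi>: "\<And>n::nat. test_function \<Omega> (\<phi> n)"
    and D: "\<forall>\<^sub>F n in sequentially. has_weak_gradient \<Omega> (\<phi> n) (D n)"
    and G: "has_weak_gradient \<Omega> u G"
    and lim: "(\<lambda>n. L2_norm_on \<Omega> (\<lambda>x. \<phi> n x - u x)) \<longlonglongrightarrow> 0"
      "(\<lambda>n. L2_norm_on \<Omega> (\<lambda>x. D n x - G x)) \<longlonglongrightarrow> 0"
    using u unfolding H10_def tendsto_H1_def by blast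
  obtain b :: 'a where b: "b \<in> Basis" using nonempty_Basis by blast
  \<comment> \<open>Scaling by \<open>4 / \<tau>\<close> moves the upper threshold 4 of
    \<open>step\<close> to \<open>\<tau>\<close>, so \<open>h\<close> and \<open>grad h\<close> are
    1 and 0 on all values of \<open>u\<close>. Both vanish at 0, which keeps supports compact after
    composition.\<close>
  define h where "h t = step (t * (4 / \<tau>))" for t :: real
  have sh: "smooth h"
    unfolding h_def by (rule smooth_dilate[OF smooth_step])
  have grad_h: "grad h t = (4 / \<tau>) * grad step (t * (4 / \<tau>))" for t
    unfolding h_def[abs_def] by (rule grad_dilate[OF smooth_step])
  have sh': "smooth (grad h)" using sh by (rule smooth_grad_real)
  have grad_h': "grad (grad h) t = (4 / \<tau>)\<^sup>2 * grad (grad step) (t * (4 / \<tau>))" for t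
    unfolding grad_h[abs_def] grad_cmult[OF smooth_dilate[OF smooth_grad_real[OF smooth_step]]]
      grad_dilate[OF smooth_grad_real[OF smooth_step]] by (simp add: power2_eq_square)
  obtain K0 where K0: "0 < K0" "\<forall>t. \<bar>grad step t\<bar> \<le> K0" using grad_step_bound by blast
  obtain L0 where L0: "0 < L0" "\<forall>t. \<bar>grad (grad step) t\<bar> \<le> L0" using grad_grad_step_bound by blast
  define K where "K = 4 / \<tau> * K0"
  define L where "L = (4 / \<tau>)\<^sup>2 * L0"
  have KL: "0 < K" "0 < L" using \<tau> K0 L0 by (auto simp: K_def L_def)
  have K: "\<bar>grad h t\<bar> \<le> K" for t
    using \<tau> K0 by (auto simp: grad_h K_def abs_mult intro!: mult_left_mono divide_right_mono)
  have L: "\<bar>grad (grad h) t\<bar> \<le> L" for t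
    using \<tau> L0 by (auto simp: grad_h' L_def abs_mult intro!: mult_left_mono)
  have h0: "h 0 = 0" "grad h 0 = 0"
    by (auto simp: grad_h h_def step_0 grad_step_eq_0)
  have h1: "h t = 1" "grad h t = 0" if "\<tau> \<le> t" for t
    using that \<tau> by (auto simp: grad_h h_def step_1 grad_step_eq_0 field_simps)
  obtain R where R: "0 < R" "\<forall>x\<in>\<Omega>. norm (x \<bullet> b) \<le> R"
    using bounded_on_dom[OF dom(1,2) smooth_continuous_on[OF smooth_inner[of b]]] by blast
  define \<psi> where "\<psi> n x = h (\<phi> n x)" for n x
  \<comment> \<open>The factor that multiplies the derivative of \<open>\<phi> n\<close> along
    \<open>b\<close> when \<open>\<psi> n x * (x \<bullet> b)\<close> is differentiated; it is again
    a test function.\<close>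
  define \<xi> where "\<xi> n x = grad h (\<phi> n x) * (x \<bullet> b)" for n x
  have s: "smooth (\<phi> n)" for n using \<phi> by (rule test_function_smooth)
  have \<psi>: "test_function \<Omega> (\<psi> n)" for n
    unfolding \<psi>_def[abs_def] using \<phi> sh h0(1) by (rule test_function_compose)
  have \<xi>: "test_function \<Omega> (\<xi> n)" for n
    unfolding \<xi>_def[abs_def]
    by (rule test_function_mult[OF test_function_compose[OF \<phi> sh' h0(2)] smooth_inner])
  have c: "continuous_on UNIV (\<phi> n)" "continuous_on UNIV (grad (\<phi> n))" "continuous_on UNIV (\<psi> n)"
    "continuous_on UNIV (\<xi> n)" for n
    using \<phi>[of n] \<psi>[of n] \<xi>[of n]
    by (auto intro: smooth_continuous_on smooth_continuous_on_grad dest!: test_function_smooth)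
  \<comment> \<open>The coordinate function has derivative 1, so integrating the derivative of the
    product isolates the integral of \<open>\<psi> n\<close>, which approximates the measure of
    \<Omega>.\<close>
  have parts1: "(LINT x|lebesgue_on \<Omega>. \<psi> n x) + (LINT x|lebesgue_on \<Omega>. (grad (\<phi> n) x \<bullet> b) * \<xi> n x) = 0" for n
  proof -
    have g: "grad (\<lambda>x. \<psi> n x * (x \<bullet> b)) x \<bullet> b = \<psi> n x + (grad (\<phi> n) x \<bullet> b) * \<xi> n x" for x
      using b by (simp add: grad_mult[OF test_function_smooth[OF \<psi>] smooth_inner] grad_inner_fun
          inner_add_left \<xi>_def) (simp add: \<psi>_def[abs_def] grad_compose[OF sh s])
    have "integrable (lebesgue_on \<Omega>) (\<lambda>x. 1 * \<psi> n x)"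
      using c by (intro integrable_mult_square_integrable sq_cont) auto
    moreover have "integrable (lebesgue_on \<Omega>) (\<lambda>x. (grad (\<phi> n) x \<bullet> b) * \<xi> n x)"
      using c by (intro integrable_mult_square_integrable sq_cont continuous_intros)
    ultimately show ?thesis
      using integral_grad_test_function[OF dom_sets[OF dom(1,2)]
          test_function_mult[OF \<psi>[of n] smooth_inner[of b]] b]
      unfolding g by simp
  qed
  \<comment> \<open>Convergence to \<open>u\<close> is given for some weak gradients
    \<open>D n\<close>, not for \<open>grad (\<phi> n)\<close>; paired with the test function
    \<open>\<xi> n\<close> the two agree.\<close>
  have parts2: "\<forall>\<^sub>F n in sequentially.
      (LINT x|lebesgue_on \<Omega>. \<psi> n x) + (LINT x|lebesgue_on \<Omega>. (D n x \<bullet> b) * \<xi> n x) = 0"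
    using D
  proof eventually_elim
    case (elim n)
    show ?case
      using parts1[of n] has_weak_gradientD(3)[OF elim \<xi>[of n] b]
        has_weak_gradientD(3)[OF has_weak_gradient_test_function[OF dom(1,2) \<phi>] \<xi>[of n] b, of n]
      by simp
  qed
  define m where "m = measure (lebesgue_on \<Omega>) \<Omega>"
  have m_pos: "0 < m"
  proof -
    have "\<Omega> \<in> lmeasurable"
      using dom by (intro bounded_set_imp_lmeasurable dom_sets)
    moreover have "\<not> negligible \<Omega>"
      using dom by (intro open_not_negligible)
    ultimately have "measure lebesgue \<Omega> \<noteq> 0"
      by (simp add: negligible_iff_measure)
    then show ?thesis
      unfolding m_def using dom_sets[OF dom(1,2)]
      by (simp add: measure_restrict_space order_less_le)
  qed
  \<comment> \<open>The coefficient of \<open>\<bar>\<phi> n x - u x\<bar>\<close> in the pointwise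
    estimate below: \<open>K\<close> comes from \<open>1 - \<psi> n x\<close>, the other term from
    \<open>grad h\<close> multiplied by \<open>G\<close> and the coordinate.\<close>
  define w where "w x = R * L * norm (G x) + K" for x
  have w: "square_integrable_on \<Omega> w"
    unfolding w_def[abs_def]
    using square_integrable_on_add[OF square_integrable_on_scaleR[OF square_integrable_on_norm
          [OF has_weak_gradientD(2)[OF G]], of "R * L"] square_integrable_on_const[OF dom(1,2), of K]]
    by simp
  define C where "C = (LINT x|lebesgue_on \<Omega>. (R * K)\<^sup>2) + (LINT x|lebesgue_on \<Omega>. (w x)\<^sup>2)"
  have bound: "\<forall>\<^sub>F n in sequentially. m \<le> \<epsilon> * C
      + ((L2_norm_on \<Omega> (\<lambda>x. D n x - G x))\<^sup>2 + (L2_norm_on \<Omega> (\<lambda>x. \<phi> n x - u x))\<^sup>2) / \<epsilon>"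
    if \<epsilon>: "0 < \<epsilon>" for \<epsilon>
    using D parts2
  proof eventually_elim
    case (elim n)
    note Dn = has_weak_gradientD[OF elim(1)]
    have d1: "square_integrable_on \<Omega> (\<lambda>x. norm (D n x - G x))"
      by (intro square_integrable_on_norm square_integrable_on_diff Dn has_weak_gradientD[OF G])
    have d2: "square_integrable_on \<Omega> (\<lambda>x. \<bar>\<phi> n x - u x\<bar>)"
      using square_integrable_on_norm[OF square_integrable_on_diff[OF Dn(1) has_weak_gradientD(1)[OF G]]]
      by simp
    have k: "square_integrable_on \<Omega> (\<lambda>x. R * K)"
      by (rule square_integrable_on_const[OF dom(1,2)])
    have i1: "integrable (lebesgue_on \<Omega>) (\<lambda>x. 1 * \<psi> n x)"
      using c by (intro integrable_mult_square_integrable sq_cont) auto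
    have "integrable (lebesgue_on \<Omega>) (\<lambda>x. D n x \<bullet> (\<xi> n x *\<^sub>R b))"
      using c by (intro integrable_inner_square_integrable Dn sq_cont continuous_intros)
    then have i2: "integrable (lebesgue_on \<Omega>) (\<lambda>x. (D n x \<bullet> b) * \<xi> n x)"
      by (simp add: mult.commute)
    have i3: "integrable (lebesgue_on \<Omega>) (\<lambda>x. (R * K) * norm (D n x - G x))"
      using k d1 by (rule integrable_mult_square_integrable)
    have i4: "integrable (lebesgue_on \<Omega>) (\<lambda>x. w x * \<bar>\<phi> n x - u x\<bar>)"
      using w d2 by (rule integrable_mult_square_integrable)
    \<comment> \<open>Since \<open>h (u x) = 1\<close> and \<open>grad h (u x) = 0\<close>, the
      Lipschitz bounds control both \<open>1 - \<psi> n x\<close> and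
      \<open>grad h (\<phi> n x)\<close> by \<open>\<bar>\<phi> n x - u x\<bar>\<close>.\<close>
    have "1 \<le> 1 * \<psi> n x + (D n x \<bullet> b) * \<xi> n x + (R * K) * norm (D n x - G x) + w x * \<bar>\<phi> n x - u x\<bar>"
      if x: "x \<in> \<Omega>" for x
    proof -
      let ?t = "\<phi> n x"
      have "\<bar>h ?t - h (u x)\<bar> \<le> K * \<bar>?t - u x\<bar>"
        using lipschitz_of_bounded_grad[OF sh K] .
      then have 1: "1 - \<psi> n x \<le> K * \<bar>?t - u x\<bar>"
        using h1(1)[OF u_ge[OF x]] by (simp add: \<psi>_def)
      have "\<bar>grad h ?t - grad h (u x)\<bar> \<le> L * \<bar>?t - u x\<bar>"
        using lipschitz_of_bounded_grad[OF sh' L] .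
      then have 2: "\<bar>grad h ?t\<bar> \<le> L * \<bar>?t - u x\<bar>"
        using h1(2)[OF u_ge[OF x]] by simp
      have xb: "\<bar>x \<bullet> b\<bar> \<le> R" using R(2) x by simp
      have "\<bar>(D n x \<bullet> b) * \<xi> n x\<bar> \<le> norm (D n x) * (\<bar>grad h ?t\<bar> * R)"
        unfolding \<xi>_def abs_mult
        using b R(1) xb norm_bound_Basis_le[OF b order_refl] Basis_le_norm[OF b]
        by (intro mult_mono) auto
      \<comment> \<open>The difference \<open>D n x - G x\<close> is small in
        \<open>L\<^sup>2\<close> and needs only the bound \<open>K\<close> for
        \<open>grad h\<close>; the fixed \<open>G\<close> is paired with the smallness of
        \<open>grad h\<close>.\<close>
      also have "\<dots> \<le> (norm (D n x - G x) + norm (G x)) * (\<bar>grad h ?t\<bar> * R)"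
        using R(1) norm_triangle_ineq[of "D n x - G x" "G x"] by (intro mult_right_mono) auto
      also have "\<dots> = norm (D n x - G x) * (\<bar>grad h ?t\<bar> * R) + norm (G x) * (\<bar>grad h ?t\<bar> * R)"
        by (simp add: algebra_simps)
      also have "\<dots> \<le> norm (D n x - G x) * (K * R) + norm (G x) * ((L * \<bar>?t - u x\<bar>) * R)"
        using R(1) K 2 by (intro add_mono mult_left_mono mult_right_mono) auto
      finally have 3: "- ((D n x \<bullet> b) * \<xi> n x)
          \<le> norm (D n x - G x) * (K * R) + norm (G x) * ((L * \<bar>?t - u x\<bar>) * R)" by simp
      have "norm (D n x - G x) * (K * R) + norm (G x) * ((L * \<bar>?t - u x\<bar>) * R) + K * \<bar>?t - u x\<bar>
          = (R * K) * norm (D n x - G x) + w x * \<bar>?t - u x\<bar>"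
        by (simp add: w_def algebra_simps)
      with 1 3 show ?thesis by linarith
    qed
    then have "(LINT x|lebesgue_on \<Omega>. 1) \<le> (LINT x|lebesgue_on \<Omega>.
        1 * \<psi> n x + (D n x \<bullet> b) * \<xi> n x + (R * K) * norm (D n x - G x) + w x * \<bar>\<phi> n x - u x\<bar>)"
      using i1 i2 i3 i4 finite_measure.integrable_const[OF finite_measure_dom[OF dom(1,2)]]
      by (intro integral_mono Bochner_Integration.integrable_add) auto
    also have "\<dots> = ((LINT x|lebesgue_on \<Omega>. \<psi> n x) + (LINT x|lebesgue_on \<Omega>. (D n x \<bullet> b) * \<xi> n x))
        + (LINT x|lebesgue_on \<Omega>. (R * K) * norm (D n x - G x))
        + (LINT x|lebesgue_on \<Omega>. w x * \<bar>\<phi> n x - u x\<bar>)"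
      using i1 i2 i3 i4 by simp
    also have "\<dots> \<le> 0 + (\<epsilon> * (LINT x|lebesgue_on \<Omega>. (R * K)\<^sup>2)
          + (LINT x|lebesgue_on \<Omega>. (norm (D n x - G x))\<^sup>2) / \<epsilon>)
        + (\<epsilon> * (LINT x|lebesgue_on \<Omega>. (w x)\<^sup>2) + (LINT x|lebesgue_on \<Omega>. (\<bar>\<phi> n x - u x\<bar>)\<^sup>2) / \<epsilon>)"
      using elim(2) integral_mult_le_weighted[OF k d1 \<epsilon>] integral_mult_le_weighted[OF w d2 \<epsilon>]
      by (intro add_mono) auto
    also have "\<dots> = \<epsilon> * C
      + ((L2_norm_on \<Omega> (\<lambda>x. D n x - G x))\<^sup>2 + (L2_norm_on \<Omega> (\<lambda>x. \<phi> n x - u x))\<^sup>2) / \<epsilon>"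
      by (simp add: C_def L2_norm_on_square algebra_simps add_divide_distrib)
    finally show ?case by (simp add: m_def)
  qed
  have "m \<le> \<epsilon> * C" if \<epsilon>: "0 < \<epsilon>" for \<epsilon>
  proof (rule tendsto_lowerbound[OF _ bound[OF \<epsilon>]])
    have "(\<lambda>n. \<epsilon> * C + ((L2_norm_on \<Omega> (\<lambda>x. D n x - G x))\<^sup>2 + (L2_norm_on \<Omega> (\<lambda>x. \<phi> n x - u x))\<^sup>2) / \<epsilon>)
        \<longlonglongrightarrow> \<epsilon> * C + (0\<^sup>2 + 0\<^sup>2) / \<epsilon>"
      using \<epsilon> by (intro tendsto_intros lim) auto
    then show "(\<lambda>n. \<epsilon> * C + ((L2_norm_on \<Omega> (\<lambda>x. D n x - G x))\<^sup>2 + (L2_norm_on \<Omega> (\<lambda>x. \<phi> n x - u x))\<^sup>2) / \<epsilon>)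
        \<longlonglongrightarrow> \<epsilon> * C" by simp
  qed simp
  \<comment> \<open>This \<epsilon> makes the right side at most \<open>m / 2\<close>;
    \<open>\<bar>C\<bar> + 1\<close> keeps the denominator positive whatever \<open>C\<close>
    is.\<close>
  from this[of "m / (2 * (\<bar>C\<bar> + 1))"] have "m \<le> m / (2 * (\<bar>C\<bar> + 1)) * C"
    using m_pos by (simp add: divide_pos_pos)
  then have "m * (2 * (\<bar>C\<bar> + 1)) \<le> m * C" by (simp add: field_simps)
  then show False using m_pos by auto
qed

section \<open>Cutoff functions of small energy\<close>

text \<open>An average of cutoffs at the scales \<open>\<rho>, 2\<rho>, 4\<rho>, \<dots>\<close>, whose gradients have disjoint
  supports. In dimension two this imitates a logarithmic cutoff.\<close>

definition cutoff :: "'a::euclidean_space \<Rightarrow> real \<Rightarrow> nat \<Rightarrow> 'a \<Rightarrow> real" where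
  "cutoff a \<rho> n x = (\<Sum>j<n. step ((norm (x - a))\<^sup>2 * (1 / (2 ^ j * \<rho>)\<^sup>2))) * (1 / n)"

lemma smooth_step_scale: "smooth (\<lambda>x. step ((norm (x - a))\<^sup>2 * c))"
  by (intro smooth_compose[OF smooth_dilate[OF smooth_step]] smooth_dist_square)

lemma smooth_cutoff: "smooth (cutoff a \<rho> n)"
  unfolding cutoff_def[abs_def] by (intro smooth_mult smooth_sum smooth_step_scale smooth_const)

lemma cutoff_bounds: "0 \<le> cutoff a \<rho> n x" "cutoff a \<rho> n x \<le> 1"
proof -
  show "0 \<le> cutoff a \<rho> n x"
    unfolding cutoff_def by (intro mult_nonneg_nonneg sum_nonneg step_bounds) simp
  have "(\<Sum>j<n. step ((norm (x - a))\<^sup>2 * (1 / (2 ^ j * \<rho>)\<^sup>2))) \<le> (\<Sum>j<n. 1)"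
    by (intro sum_mono step_bounds)
  then show "cutoff a \<rho> n x \<le> 1"
    by (cases "n = 0") (auto simp: cutoff_def divide_le_eq)
qed

lemma cutoff_eq_0:
  assumes "0 < \<rho>" "norm (x - a) \<le> \<rho>"
  shows "cutoff a \<rho> n x = 0"
proof -
  have "step ((norm (x - a))\<^sup>2 * (1 / (2 ^ j * \<rho>)\<^sup>2)) = 0" for j
  proof (rule step_0)
    have "norm (x - a) \<le> 2 ^ j * \<rho>"
    proof -
      have "1 * \<rho> \<le> 2 ^ j * \<rho>" using assms(1) by (intro mult_right_mono) auto
      then show ?thesis using assms(2) by linarith
    qed
    then have "(norm (x - a))\<^sup>2 \<le> (2 ^ j * \<rho>)\<^sup>2" by (intro power_mono) auto
    then show "(norm (x - a))\<^sup>2 * (1 / (2 ^ j * \<rho>)\<^sup>2) \<le> 1"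
      using assms(1) by (simp add: divide_le_eq)
  qed
  then show ?thesis by (simp add: cutoff_def)
qed

text \<open>The largest scale is \<open>2 ^ (n - 1) * \<rho>\<close>, and its transition ends at
  twice that radius.\<close>

lemma cutoff_eq_1:
  assumes "0 < \<rho>" "0 < n" "2 ^ n * \<rho> \<le> norm (x - a)"
  shows "cutoff a \<rho> n x = 1"
proof -
  have "step ((norm (x - a))\<^sup>2 * (1 / (2 ^ j * \<rho>)\<^sup>2)) = 1" if "j < n" for j
  proof (rule step_1)
    have "2 ^ Suc j * \<rho> \<le> 2 ^ n * \<rho>"
      using assms(1) that by (intro mult_right_mono power_increasing) auto
    then have "2 * (2 ^ j * \<rho>) \<le> norm (x - a)" using assms(3) by simp
    then have "(2 * (2 ^ j * \<rho>))\<^sup>2 \<le> (norm (x - a))\<^sup>2"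
      using assms(1) by (intro power_mono) auto
    then have "4 * (2 ^ j * \<rho>)\<^sup>2 \<le> (norm (x - a))\<^sup>2"
      by (simp add: power_mult_distrib)
    then show "4 \<le> (norm (x - a))\<^sup>2 * (1 / (2 ^ j * \<rho>)\<^sup>2)"
      using assms(1) by (simp add: le_divide_eq)
  qed
  then show ?thesis using assms(2) by (simp add: cutoff_def)
qed

lemma grad_step_scale:
  "grad (\<lambda>x. step ((norm (x - a))\<^sup>2 * c)) x
    = (2 * c * grad step ((norm (x - a))\<^sup>2 * c)) *\<^sub>R (x - a)"
  using grad_compose[OF smooth_dilate[OF smooth_step, of c] smooth_dist_square[of a], of x]
  by (simp add: grad_dilate[OF smooth_step] grad_dist_square mult.commute)

text \<open>The chain rule gives \<open>2 / s\<^sup>2\<close>, a derivative of at most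
  \<open>K\<close> and a distance of at most \<open>2 * s\<close>: together
  \<open>4 * K / s\<close>, whose square contains the 16.\<close>

lemma norm_grad_step_scale:
  assumes K: "\<forall>t. \<bar>grad step t\<bar> \<le> K" and s: "0 < s"
  shows "(norm (grad (\<lambda>x. step ((norm (x - a))\<^sup>2 * (1 / s\<^sup>2))) x))\<^sup>2
      \<le> 16 * K\<^sup>2 / s\<^sup>2 * indicator (ball a (2 * s)) x"
    and "norm (x - a) \<le> s \<or> 2 * s \<le> norm (x - a) \<Longrightarrow>
      grad (\<lambda>x. step ((norm (x - a))\<^sup>2 * (1 / s\<^sup>2))) x = 0"
proof -
  let ?g = "grad step ((norm (x - a))\<^sup>2 * (1 / s\<^sup>2))"
  show *: "grad (\<lambda>x. step ((norm (x - a))\<^sup>2 * (1 / s\<^sup>2))) x = 0"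
    if "norm (x - a) \<le> s \<or> 2 * s \<le> norm (x - a)"
  proof -
    have "(norm (x - a))\<^sup>2 \<le> s\<^sup>2 \<or> (2 * s)\<^sup>2 \<le> (norm (x - a))\<^sup>2"
      using that s power_mono[of "norm (x - a)" s 2] power_mono[of "2 * s" "norm (x - a)" 2] by auto
    then have "?g = 0"
      using s by (intro grad_step_eq_0) (auto simp: divide_le_eq le_divide_eq power_mult_distrib)
    then show ?thesis by (subst grad_step_scale) simp
  qed
  have K0: "0 \<le> K" using K abs_ge_zero order_trans by blast
  show "(norm (grad (\<lambda>x. step ((norm (x - a))\<^sup>2 * (1 / s\<^sup>2))) x))\<^sup>2
      \<le> 16 * K\<^sup>2 / s\<^sup>2 * indicator (ball a (2 * s)) x"
  proof (cases "2 * s \<le> norm (x - a)")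
    case True
    then show ?thesis using * by simp
  next
    case False
    have "norm (grad (\<lambda>x. step ((norm (x - a))\<^sup>2 * (1 / s\<^sup>2))) x) = 2 / s\<^sup>2 * \<bar>?g\<bar> * norm (x - a)"
      by (subst grad_step_scale) (simp add: abs_mult)
    also have "\<dots> \<le> 2 / s\<^sup>2 * K * (2 * s)"
      using K K0 s False by (intro mult_mono) auto
    also have "\<dots> = 4 * K / s" using s by (simp add: power2_eq_square)
    finally have "(norm (grad (\<lambda>x. step ((norm (x - a))\<^sup>2 * (1 / s\<^sup>2))) x))\<^sup>2 \<le> (4 * K / s)\<^sup>2"
      by (intro power_mono) auto
    moreover have "x \<in> ball a (2 * s)"
      using False by (simp add: dist_norm norm_minus_commute)
    ultimately show ?thesis by (simp add: power_divide power_mult_distrib)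
  qed
qed

text \<open>At each point at most one summand has a nonzero gradient, so the squared norm of the sum
  is the sum of the squared norms. The weight 1 / n is squared while only n terms add up, which is
  the gain from averaging.\<close>

lemma norm_grad_cutoff:
  assumes K: "\<forall>t. \<bar>grad step t\<bar> \<le> K" and \<rho>: "0 < \<rho>"
  shows "(norm (grad (cutoff a \<rho> n) x))\<^sup>2
    \<le> (\<Sum>j<n. 16 * K\<^sup>2 / (2 ^ j * \<rho>)\<^sup>2 * indicator (ball a (2 * (2 ^ j * \<rho>))) x) / n\<^sup>2"
proof -
  let ?s = "\<lambda>j. 2 ^ j * \<rho>"
  let ?g = "\<lambda>j. grad (\<lambda>x. step ((norm (x - a))\<^sup>2 * (1 / (?s j)\<^sup>2))) x"
  have s: "0 < ?s j" for j using \<rho> by simp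
  have less: "?g i = 0 \<or> ?g j = 0" if "i < j" for i j
  proof -
    have "2 ^ Suc i * \<rho> \<le> 2 ^ j * \<rho>"
      using \<rho> that by (intro mult_right_mono power_increasing) auto
    then have "2 * ?s i \<le> norm (x - a) \<or> norm (x - a) \<le> ?s j" by auto
    then show ?thesis
      using norm_grad_step_scale(2)[OF K s, of x a i] norm_grad_step_scale(2)[OF K s, of x a j]
      by blast
  qed
  then have "pairwise (\<lambda>i j. orthogonal (?g i) (?g j)) {..<n}"
    unfolding pairwise_def orthogonal_def by (metis inner_zero_left inner_zero_right linorder_neqE_nat)
  then have eq: "(norm (\<Sum>j<n. ?g j))\<^sup>2 = (\<Sum>j<n. (norm (?g j))\<^sup>2)"
    by (intro norm_sum_Pythagorean) auto
  have "grad (cutoff a \<rho> n) x = (1 / n) *\<^sub>R (\<Sum>j<n. ?g j)"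
    unfolding cutoff_def[abs_def] grad_mult[OF smooth_sum[OF smooth_step_scale] smooth_const]
      grad_sum[OF smooth_step_scale] by simp
  then have "(norm (grad (cutoff a \<rho> n) x))\<^sup>2 = (norm (\<Sum>j<n. ?g j))\<^sup>2 / n\<^sup>2"
    by (simp add: power_divide)
  also have "\<dots> = (\<Sum>j<n. (norm (?g j))\<^sup>2) / n\<^sup>2"
    by (simp only: eq)
  also have "\<dots> \<le> (\<Sum>j<n. 16 * K\<^sup>2 / (?s j)\<^sup>2 * indicator (ball a (2 * ?s j)) x) / n\<^sup>2"
    by (intro divide_right_mono sum_mono norm_grad_step_scale[OF K s]) auto
  finally show ?thesis .
qed

section \<open>Energy of the cut-off eigenfunction\<close>

lemma integrable_indicator_ball:
  assumes "\<Omega> \<in> sets lebesgue"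
  shows "integrable (lebesgue_on \<Omega>) (indicator (ball a r) :: 'a::euclidean_space \<Rightarrow> real)"
    and "(LINT x|lebesgue_on \<Omega>. indicator (ball a r) x) \<le> measure lebesgue (ball a r)"
proof -
  have b: "\<Omega> \<inter> ball a r \<in> lmeasurable"
    using assms by (intro bounded_set_imp_lmeasurable) (auto intro: sets.Int)
  have e: "integrable (lebesgue_on \<Omega>) (indicator (ball a r) :: 'a \<Rightarrow> real)
      \<and> (LINT x|lebesgue_on \<Omega>. indicator (ball a r) x) = measure lebesgue (\<Omega> \<inter> ball a r)"
  proof
    have i: "(\<lambda>x. indicator \<Omega> x *\<^sub>R indicator (ball a r) x) = (indicator (\<Omega> \<inter> ball a r) :: 'a \<Rightarrow> real)"
      by (auto simp: indicator_def fun_eq_iff)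
    show "integrable (lebesgue_on \<Omega>) (indicator (ball a r) :: 'a \<Rightarrow> real)"
    proof -
      have "integrable lebesgue (indicator (\<Omega> \<inter> ball a r) :: 'a \<Rightarrow> real)"
        using b by (intro integrable_real_indicator) (auto simp: fmeasurable_def)
      then show ?thesis
        using assms by (simp add: integrable_restrict_space i del: real_scaleR_def)
    qed
    show "(LINT x|lebesgue_on \<Omega>. indicator (ball a r) x) = measure lebesgue (\<Omega> \<inter> ball a r)"
      using assms by (subst integral_restrict_space) (simp_all add: i del: real_scaleR_def)
  qed
  then show "integrable (lebesgue_on \<Omega>) (indicator (ball a r) :: 'a::euclidean_space \<Rightarrow> real)" by blast
  show "(LINT x|lebesgue_on \<Omega>. indicator (ball a r) x) \<le> measure lebesgue (ball a r)"
  proof -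
    have "measure lebesgue (\<Omega> \<inter> ball a r) \<le> measure lebesgue (ball a r)"
      using fmeasurableD[OF b] by (intro measure_mono_fmeasurable) auto
    then show ?thesis using e by simp
  qed
qed

text \<open>The smallness of \<open>e\<close> is used only in \<open>ball a d\<close>, outside which
  all gradients vanish because \<open>2 ^ n * \<rho> \<le> d\<close>. A scale s contributes
  \<open>s ^ DIM('a) / s\<^sup>2\<close> up to constants: the volume of the ball of radius 2s times
  the squared gradient bound. In dimension two this does not depend on s.\<close>

lemma cutoff_energy:
  fixes \<Omega> :: "'a::euclidean_space set" and e :: "'a \<Rightarrow> real"
  assumes dom: "open \<Omega>" "bounded \<Omega>" and K: "\<forall>t. \<bar>grad step t\<bar> \<le> K"
    and \<rho>: "0 < \<rho>" "2 ^ n * \<rho> \<le> d" and e: "\<And>x. x \<in> \<Omega> \<inter> ball a d \<Longrightarrow> \<bar>e x\<bar> \<le> \<tau>"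
  shows "(LINT x|lebesgue_on \<Omega>. (e x)\<^sup>2 * (norm (grad (cutoff a \<rho> n) x))\<^sup>2)
    \<le> 16 * K\<^sup>2 * \<tau>\<^sup>2 * unit_ball_vol DIM('a) * 2 ^ DIM('a)
        * (\<Sum>j<n. (2 ^ j * \<rho>) ^ DIM('a) / (2 ^ j * \<rho>)\<^sup>2) / n\<^sup>2"
proof -
  let ?s = "\<lambda>j. 2 ^ j * \<rho>"
  let ?h = "\<lambda>x. \<tau>\<^sup>2 * ((\<Sum>j<n. 16 * K\<^sup>2 / (?s j)\<^sup>2 * indicator (ball a (2 * ?s j)) x) / n\<^sup>2)"
  have \<Omega>: "\<Omega> \<in> sets lebesgue" using dom by (rule dom_sets)
  note ind = integrable_indicator_ball[OF \<Omega>]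
  have ih: "integrable (lebesgue_on \<Omega>) ?h"
    using ind(1) by (intro integrable_mult_right integrable_divide Bochner_Integration.integrable_sum)
  have le: "(e x)\<^sup>2 * (norm (grad (cutoff a \<rho> n) x))\<^sup>2 \<le> ?h x" if "x \<in> \<Omega>" for x
  proof (cases "x \<in> ball a d")
    case True
    then have "(e x)\<^sup>2 \<le> \<tau>\<^sup>2"
      using e[of x] that by (metis IntI abs_ge_zero order_trans power2_abs power_mono)
    then show ?thesis
      using norm_grad_cutoff[OF K \<rho>(1)] by (intro mult_mono) auto
  next
    case False
    have "x \<notin> ball a (2 * ?s j)" if "j < n" for j
    proof -
      have "2 ^ Suc j * \<rho> \<le> 2 ^ n * \<rho>"
        using \<rho> that by (intro mult_right_mono power_increasing) auto
      then show ?thesis using False \<rho>(2) by auto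
    qed
    then have "(\<Sum>j<n. 16 * K\<^sup>2 / (?s j)\<^sup>2 * indicator (ball a (2 * ?s j)) x) = 0"
      by (intro sum.neutral) simp
    then show ?thesis
      using norm_grad_cutoff[OF K \<rho>(1), of a n x] by simp
  qed
  have "(LINT x|lebesgue_on \<Omega>. (e x)\<^sup>2 * (norm (grad (cutoff a \<rho> n) x))\<^sup>2) \<le> (LINT x|lebesgue_on \<Omega>. ?h x)"
  proof (rule integral_mono_AE'[OF ih])
    have "0 \<le> ?h x" for x
      by (intro mult_nonneg_nonneg divide_nonneg_nonneg sum_nonneg) auto
    then show "AE x in lebesgue_on \<Omega>. 0 \<le> ?h x" by (intro AE_I2)
    show "AE x in lebesgue_on \<Omega>. (e x)\<^sup>2 * (norm (grad (cutoff a \<rho> n) x))\<^sup>2 \<le> ?h x"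
      by (intro AE_I2 le) simp
  qed
  also have "\<dots> = \<tau>\<^sup>2 * ((\<Sum>j<n. 16 * K\<^sup>2 / (?s j)\<^sup>2
      * (LINT x|lebesgue_on \<Omega>. indicator (ball a (2 * ?s j)) x)) / n\<^sup>2)"
    using ind(1) by (simp add: Bochner_Integration.integral_sum)
  also have "\<dots> \<le> \<tau>\<^sup>2 * ((\<Sum>j<n. 16 * K\<^sup>2 / (?s j)\<^sup>2
      * (unit_ball_vol DIM('a) * (2 * ?s j) ^ DIM('a))) / n\<^sup>2)"
  proof (intro mult_left_mono divide_right_mono sum_mono)
    fix j
    have "0 \<le> 2 * ?s j" using \<rho> by simp
    then show "(LINT x|lebesgue_on \<Omega>. indicator (ball a (2 * ?s j)) x)
        \<le> unit_ball_vol DIM('a) * (2 * ?s j) ^ DIM('a)"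
      using ind(2)[of a "2 * ?s j"] content_ball[of "2 * ?s j" a] by simp
  qed auto
  also have "\<dots> = 16 * K\<^sup>2 * \<tau>\<^sup>2 * unit_ball_vol DIM('a) * 2 ^ DIM('a)
        * (\<Sum>j<n. ?s j ^ DIM('a) / (?s j)\<^sup>2) / n\<^sup>2"
  proof -
    have "16 * K\<^sup>2 / (?s j)\<^sup>2 * (unit_ball_vol DIM('a) * (2 * ?s j) ^ DIM('a))
        = (16 * K\<^sup>2 * unit_ball_vol DIM('a) * 2 ^ DIM('a)) * (?s j ^ DIM('a) / (?s j)\<^sup>2)" for j
      by (subst power_mult_distrib) simp
    then show ?thesis by (simp only: sum_distrib_left[symmetric]) simp
  qed
  finally show ?thesis .
qed

text \<open>Pairing \<open>De\<close> with the gradient of the test function already produces the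
  whole cross term of the expanded square. What remains is exactly the last integral, so the
  relation is an identity.\<close>

lemma eigenfunction_cutoff_energy:
  fixes \<Omega> :: "'a::euclidean_space set"
  assumes dom: "open \<Omega>" "bounded \<Omega>"
    and e: "e \<in> H10 \<Omega>" and De: "has_weak_gradient \<Omega> e De"
    and weak: "\<And>v Dv. v \<in> H10 \<Omega> \<Longrightarrow> has_weak_gradient \<Omega> v Dv \<Longrightarrow>
      (LINT x|lebesgue_on \<Omega>. De x \<bullet> Dv x) = (LINT x|lebesgue_on \<Omega>. lam * e x * v x)"
    and \<eta>: "smooth \<eta>"
  shows "(LINT x|lebesgue_on \<Omega>. (norm (\<eta> x *\<^sub>R De x + e x *\<^sub>R grad \<eta> x))\<^sup>2)
    = lam * (LINT x|lebesgue_on \<Omega>. (e x * \<eta> x)\<^sup>2)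
      + (LINT x|lebesgue_on \<Omega>. (e x)\<^sup>2 * (norm (grad \<eta> x))\<^sup>2)"
proof -
  let ?V = "\<lambda>x. \<eta> x *\<^sub>R (\<eta> x *\<^sub>R De x + e x *\<^sub>R grad \<eta> x) + (e x * \<eta> x) *\<^sub>R grad \<eta> x"
  have v: "(\<lambda>x. e x * \<eta> x * \<eta> x) \<in> H10 \<Omega>"
    by (intro H10_mult[OF dom] e \<eta>)
  have V: "has_weak_gradient \<Omega> (\<lambda>x. e x * \<eta> x * \<eta> x) ?V"
    by (intro has_weak_gradient_mult[OF dom] De \<eta>)
  have i: "integrable (lebesgue_on \<Omega>) (\<lambda>x. De x \<bullet> ?V x)"
    by (intro integrable_inner_square_integrable has_weak_gradientD(2)[OF De] has_weak_gradientD(2)[OF V])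
  have "square_integrable_on \<Omega> (\<lambda>x. e x *\<^sub>R grad \<eta> x)"
    using square_integrable_on_scaleR_continuous[OF dom has_weak_gradientD(1)[OF De]
        smooth_continuous_on_grad[OF \<eta>]] .
  then have j: "integrable (lebesgue_on \<Omega>) (\<lambda>x. (e x)\<^sup>2 * (norm (grad \<eta> x))\<^sup>2)"
    by (simp add: square_integrable_on_def power_mult_distrib)
  have "(norm (\<eta> x *\<^sub>R De x + e x *\<^sub>R grad \<eta> x))\<^sup>2 = De x \<bullet> ?V x + (e x)\<^sup>2 * (norm (grad \<eta> x))\<^sup>2" for x
    unfolding power2_norm_eq_inner
    by (simp add: inner_add_left inner_add_right inner_commute power2_eq_square algebra_simps)
  then have "(LINT x|lebesgue_on \<Omega>. (norm (\<eta> x *\<^sub>R De x + e x *\<^sub>R grad \<eta> x))\<^sup>2)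
      = (LINT x|lebesgue_on \<Omega>. De x \<bullet> ?V x) + (LINT x|lebesgue_on \<Omega>. (e x)\<^sup>2 * (norm (grad \<eta> x))\<^sup>2)"
    using i j by simp
  also have "(LINT x|lebesgue_on \<Omega>. De x \<bullet> ?V x) = (LINT x|lebesgue_on \<Omega>. lam * e x * (e x * \<eta> x * \<eta> x))"
    by (rule weak[OF v V])
  also have "\<dots> = lam * (LINT x|lebesgue_on \<Omega>. (e x * \<eta> x)\<^sup>2)"
    by (subst Bochner_Integration.integral_mult_right_zero[symmetric])
      (simp add: power2_eq_square mult.assoc mult.left_commute)
  finally show ?thesis .
qed

section \<open>Concentrated bumps\<close>

text \<open>The standard mollifier, exp (-1 / (1 - |x|^2)) in the unit ball and 0 elsewhere, without
  normalisation.\<close>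

definition bump :: "'a::euclidean_space \<Rightarrow> real" where
  "bump x = flat 0 (1 - (norm x)\<^sup>2)"

lemma bump_nonneg: "0 \<le> bump x"
  by (simp add: bump_def flat_0_nonneg)

lemma bump_eq_0: "x \<notin> ball 0 1 \<Longrightarrow> bump x = 0"
  using power_mono[of 1 "norm x" 2] by (simp add: bump_def flat_0_eq)

lemma smooth_bump_scaled: "smooth (\<lambda>x. bump (c *\<^sub>R (x - a)))"
proof -
  have "smooth (\<lambda>x. flat 0 (1 + - ((norm (x - a))\<^sup>2 * c\<^sup>2)))"
    by (intro smooth_compose[OF smooth_flat] smooth_add smooth_minus smooth_mult smooth_const
        smooth_dist_square)
  then show ?thesis by (simp add: bump_def[abs_def] power_mult_distrib mult.commute)
qed

lemma smooth_bump: "smooth bump"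
  using smooth_bump_scaled[of 1 0] by simp

lemma grad_bump_scaled: "grad (\<lambda>x. bump (c *\<^sub>R (x - a))) x = c *\<^sub>R grad bump (c *\<^sub>R (x - a))"
proof (rule has_derivative_grad)
  have "((\<lambda>x. c *\<^sub>R (x - a)) has_derivative (\<lambda>v. c *\<^sub>R v)) (at x)"
    by (auto intro!: derivative_eq_intros)
  from has_derivative_compose[OF this smooth_has_derivative[OF smooth_bump]]
  show "((\<lambda>x. bump (c *\<^sub>R (x - a))) has_derivative (\<lambda>v. (c *\<^sub>R grad bump (c *\<^sub>R (x - a))) \<bullet> v)) (at x)"
    by simp
qed

lemma test_function_bump_scaled:
  assumes "0 < \<rho>" "cball a \<rho> \<subseteq> \<Omega>"
  shows "test_function \<Omega> (\<lambda>x. bump ((1 / \<rho>) *\<^sub>R (x - a)))"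
  unfolding test_function_iff
proof (intro conjI smooth_bump_scaled exI[of _ "cball a \<rho>"] allI impI)
  fix x assume "x \<notin> cball a \<rho>"
  then have "(1 / \<rho>) *\<^sub>R (x - a) \<notin> ball 0 1"
    using assms(1) by (simp add: dist_norm norm_minus_commute le_divide_eq)
  then show "bump ((1 / \<rho>) *\<^sub>R (x - a)) = 0" by (rule bump_eq_0)
qed (use assms in auto)

text \<open>If the integral vanished, the set where \<open>f\<close> is nonzero would be negligible;
  by continuity it is open, and a nonempty open set is not negligible.\<close>

lemma integral_pos_of_continuous:
  fixes f :: "'a::euclidean_space \<Rightarrow> real"
  assumes "continuous_on UNIV f" "compact K" "\<forall>x. x \<notin> K \<longrightarrow> f x = 0" "\<And>x. 0 \<le> f x" "f z \<noteq> 0"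
  shows "0 < (LINT x|lborel. f x)"
proof -
  have i: "integrable lborel f"
    using assms(1-3) by (rule integrable_continuous_compact_support)
  have "(LINT x|lborel. f x) \<noteq> 0"
  proof
    assume "(LINT x|lborel. f x) = 0"
    then have "AE x in lborel. f x = 0"
      using integral_nonneg_eq_0_iff_AE[OF i] assms(4) by simp
    then have "AE x in lebesgue. f x = 0" by (rule AE_completion)
    then obtain N where "N \<in> null_sets lebesgue" "{x. f x \<noteq> 0} \<subseteq> N"
      unfolding eventually_ae_filter by auto
    then have "negligible {x. f x \<noteq> 0}"
      using negligible_iff_null_sets negligible_subset by blast
    moreover have "open {x. f x \<noteq> 0}"
      using assms(1) by (intro open_Collect_neq) auto
    ultimately show False using open_not_negligible assms(5) by blast
  qed
  moreover have "0 \<le> (LINT x|lborel. f x)"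
    using assms(4) by (intro integral_nonneg_AE) auto
  ultimately show ?thesis by simp
qed

lemma integral_bump_square_pos: "0 < (LINT x|lborel. (bump (x::'a::euclidean_space))\<^sup>2)"
  by (rule integral_pos_of_continuous[where K = "cball 0 1" and z = 0])
    (auto intro!: continuous_intros smooth_continuous_on[OF smooth_bump] bump_eq_0
      simp: bump_def[of 0] flat_0_eq)

lemma grad_bump_eq_0: "x \<notin> cball 0 1 \<Longrightarrow> grad bump x = 0"
  by (rule grad_eq_0_outside_support[of "cball 0 1"]) (auto intro: bump_eq_0)

text \<open>Makes the constant linking \<rho> and \<beta> positive. A vanishing gradient would force
  \<open>bump\<close> to be constant, but it is positive at 0 and zero at unit vectors.\<close>

lemma integral_grad_bump_pos: "0 < (LINT x|lborel. (norm (grad bump (x::'a::euclidean_space)))\<^sup>2)"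
proof -
  have "\<exists>z::'a. grad bump z \<noteq> 0"
  proof (rule ccontr)
    assume *: "\<not> (\<exists>z::'a. grad bump z \<noteq> 0)"
    obtain b :: 'a where b: "b \<in> Basis" using nonempty_Basis by blast
    have "(bump has_derivative (\<lambda>v. 0)) (at x within UNIV)" for x :: 'a
      using smooth_has_derivative[OF smooth_bump, of x] * by simp
    then obtain c where "\<And>x::'a. x \<in> UNIV \<Longrightarrow> bump x = c"
      using has_derivative_zero_constant[of "UNIV :: 'a set" bump] by auto
    then have "bump (0::'a) = bump b" by simp
    then show False using b by (simp add: bump_def flat_0_eq)
  qed
  then obtain z :: 'a where "grad bump z \<noteq> 0" by blast
  then show ?thesis
    by (intro integral_pos_of_continuous[where K = "cball 0 1" and z = z])
      (auto intro!: continuous_intros smooth_continuous_on_grad[OF smooth_bump] grad_bump_eq_0)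
qed

text \<open>In every dimension the quotient of the two energies is a constant times
  \<open>1 / \<rho>\<^sup>2\<close>; so the normalised bump can be given any large energy by the
  choice of \<rho>.\<close>

lemma bump_scaled_energies:
  fixes \<Omega> :: "'a::euclidean_space set"
  assumes "\<Omega> \<in> sets lebesgue" "0 < \<rho>" "cball a \<rho> \<subseteq> \<Omega>"
  shows "(LINT x|lebesgue_on \<Omega>. (bump ((1 / \<rho>) *\<^sub>R (x - a)))\<^sup>2)
      = \<rho> ^ DIM('a) * (LINT x|lborel. (bump (x::'a))\<^sup>2)"
    and "(LINT x|lebesgue_on \<Omega>. (norm (grad (\<lambda>x. bump ((1 / \<rho>) *\<^sub>R (x - a))) x))\<^sup>2)
      = \<rho> ^ DIM('a) / \<rho>\<^sup>2 * (LINT x|lborel. (norm (grad bump (x::'a)))\<^sup>2)"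
proof -
  have out: "(1 / \<rho>) *\<^sub>R (x - a) \<notin> cball 0 1" if "x \<notin> \<Omega>" for x
  proof -
    have "x \<notin> cball a \<rho>" using that assms(3) by blast
    then show ?thesis using assms(2) by (simp add: dist_norm norm_minus_commute divide_le_eq)
  qed
  have m1: "(\<lambda>x::'a. (bump x)\<^sup>2) \<in> borel_measurable borel"
    by (intro borel_measurable_continuous_onI continuous_intros smooth_continuous_on[OF smooth_bump])
  have m2: "(\<lambda>x::'a. (norm (grad bump x))\<^sup>2) \<in> borel_measurable borel"
    by (intro borel_measurable_continuous_onI continuous_intros smooth_continuous_on_grad[OF smooth_bump])
  have T: "(\<lambda>x. (1 / \<rho>) *\<^sub>R (x - a)) \<in> borel_measurable borel"
    by (intro borel_measurable_continuous_onI continuous_intros)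
  have "(LINT x|lebesgue_on \<Omega>. (bump ((1 / \<rho>) *\<^sub>R (x - a)))\<^sup>2)
      = (LINT x|lborel. (bump ((1 / \<rho>) *\<^sub>R (x - a)))\<^sup>2)"
    using out measurable_compose[OF T m1]
    by (intro integral_lebesgue_on_eq_lborel[OF assms(1)]) (auto simp del: mem_ball intro!: bump_eq_0 dest!: out)
  also have "\<dots> = \<rho> ^ DIM('a) * (LINT x|lborel. (bump (x::'a))\<^sup>2)"
    by (rule integral_lborel_scaling[OF m1 assms(2)])
  finally show "(LINT x|lebesgue_on \<Omega>. (bump ((1 / \<rho>) *\<^sub>R (x - a)))\<^sup>2)
      = \<rho> ^ DIM('a) * (LINT x|lborel. (bump (x::'a))\<^sup>2)" .
  have "(LINT x|lebesgue_on \<Omega>. (norm (grad (\<lambda>x. bump ((1 / \<rho>) *\<^sub>R (x - a))) x))\<^sup>2)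
      = (1 / \<rho>\<^sup>2) * (LINT x|lebesgue_on \<Omega>. (norm (grad bump ((1 / \<rho>) *\<^sub>R (x - a))))\<^sup>2)"
    unfolding grad_bump_scaled by (simp add: power_mult_distrib power_divide)
  also have "(LINT x|lebesgue_on \<Omega>. (norm (grad bump ((1 / \<rho>) *\<^sub>R (x - a))))\<^sup>2)
      = (LINT x|lborel. (norm (grad bump ((1 / \<rho>) *\<^sub>R (x - a))))\<^sup>2)"
    using out measurable_compose[OF T m2]
    by (intro integral_lebesgue_on_eq_lborel[OF assms(1)]) (auto simp: grad_bump_eq_0)
  also have "\<dots> = \<rho> ^ DIM('a) * (LINT x|lborel. (norm (grad bump (x::'a)))\<^sup>2)"
    by (rule integral_lborel_scaling[OF m2 assms(2)])
  finally show "(LINT x|lebesgue_on \<Omega>. (norm (grad (\<lambda>x. bump ((1 / \<rho>) *\<^sub>R (x - a))) x))\<^sup>2)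
      = \<rho> ^ DIM('a) / \<rho>\<^sup>2 * (LINT x|lborel. (norm (grad bump (x::'a)))\<^sup>2)"
    by simp
qed

section \<open>The competitor\<close>

lemma L2_norm_on_eq_1:
  "(LINT x|lebesgue_on \<Omega>. (norm (f x))\<^sup>2) = 1 \<Longrightarrow> L2_norm_on \<Omega> f = 1"
  by (simp add: L2_norm_on_def)

lemma L2_norm_on_cong: "(\<And>x. x \<in> \<Omega> \<Longrightarrow> f x = g x) \<Longrightarrow> L2_norm_on \<Omega> f = L2_norm_on \<Omega> g"
  unfolding L2_norm_on_def by (metis (mono_tags, lifting) Bochner_Integration.integral_cong space_lebesgue_on)

text \<open>The cutoff is 1 outside \<open>ball a d\<close>, so at most the mass of \<open>e\<close>
  in that ball is lost, and this is bounded by \<open>\<tau>\<^sup>2\<close> times the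
  volume.\<close>

lemma cutoff_mass:
  fixes \<Omega> :: "'a::euclidean_space set" and e :: "'a \<Rightarrow> real"
  assumes dom: "open \<Omega>" "bounded \<Omega>" and e: "square_integrable_on \<Omega> e" "L2_norm_on \<Omega> e = 1"
    and \<tau>: "\<And>x. x \<in> \<Omega> \<inter> ball a d \<Longrightarrow> \<bar>e x\<bar> \<le> \<tau>"
    and small: "\<tau>\<^sup>2 * measure lebesgue (ball a d) \<le> 1 / 2"
    and \<rho>: "0 < \<rho>" "0 < n" "2 ^ n * \<rho> \<le> d"
  shows "1 / 2 \<le> (LINT x|lebesgue_on \<Omega>. (e x * cutoff a \<rho> n x)\<^sup>2)"
proof -
  note ind = integrable_indicator_ball[OF dom_sets[OF dom], of a d]
  have "square_integrable_on \<Omega> (\<lambda>x. cutoff a \<rho> n x *\<^sub>R e x)"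
    by (rule square_integrable_on_mult_continuous[OF dom e(1) smooth_continuous_on[OF smooth_cutoff]])
  then have i: "integrable (lebesgue_on \<Omega>) (\<lambda>x. (e x * cutoff a \<rho> n x)\<^sup>2)"
    by (simp add: square_integrable_on_def mult.commute)
  have j: "integrable (lebesgue_on \<Omega>) (\<lambda>x. (e x)\<^sup>2)"
    using e(1) by (simp add: square_integrable_on_def)
  have "(e x)\<^sup>2 \<le> (e x * cutoff a \<rho> n x)\<^sup>2 + \<tau>\<^sup>2 * indicator (ball a d) x" if "x \<in> \<Omega>" for x
  proof (cases "x \<in> ball a d")
    case True
    then have "(e x)\<^sup>2 \<le> \<tau>\<^sup>2"
      using power_mono[OF \<tau>[of x], of 2] that by simp
    then show ?thesis using True by (simp add: add_increasing)
  next
    case False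
    then have "cutoff a \<rho> n x = 1"
      using \<rho> by (intro cutoff_eq_1) (auto simp: dist_norm norm_minus_commute)
    then show ?thesis by simp
  qed
  then have "(LINT x|lebesgue_on \<Omega>. (e x)\<^sup>2)
      \<le> (LINT x|lebesgue_on \<Omega>. (e x * cutoff a \<rho> n x)\<^sup>2 + \<tau>\<^sup>2 * indicator (ball a d) x)"
    using i j ind(1) by (intro integral_mono) auto
  also have "\<dots> = (LINT x|lebesgue_on \<Omega>. (e x * cutoff a \<rho> n x)\<^sup>2)
      + \<tau>\<^sup>2 * (LINT x|lebesgue_on \<Omega>. indicator (ball a d) x)"
    using i ind(1) by simp
  also have "\<dots> \<le> (LINT x|lebesgue_on \<Omega>. (e x * cutoff a \<rho> n x)\<^sup>2) + 1 / 2"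
    using mult_left_mono[OF ind(2), of "\<tau>\<^sup>2"] small by simp
  finally show ?thesis
    using L2_norm_on_square[of \<Omega> e] e(2) by simp
qed

text \<open>A real \<open>Inf\<close> is known to be a lower bound only for sets bounded below; here
  0 is a bound because energies are nonnegative.\<close>

lemma fucik_inf_le:
  assumes "u \<in> H10 \<Omega>" "has_weak_gradient \<Omega> (pos_part u) Dp" "has_weak_gradient \<Omega> (neg_part u) Dm"
    and "L2_norm_on \<Omega> (pos_part u) = 1" "L2_norm_on \<Omega> (neg_part u) = 1"
    and "(LINT x|lebesgue_on \<Omega>. (norm (Dp x))\<^sup>2) = \<beta>"
  shows "fucik_inf \<Omega> \<beta> \<le> (LINT x|lebesgue_on \<Omega>. (norm (Dm x))\<^sup>2)"
  unfolding fucik_inf_def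
proof (rule cInf_lower)
  show "bdd_below {LINT x|lebesgue_on \<Omega>. (norm (Dm x))\<^sup>2 |u Dp Dm.
     u \<in> H10 \<Omega> \<and> has_weak_gradient \<Omega> (pos_part u) Dp \<and> has_weak_gradient \<Omega> (neg_part u) Dm \<and>
     L2_norm_on \<Omega> (pos_part u) = 1 \<and> L2_norm_on \<Omega> (neg_part u) = 1 \<and>
     (LINT x|lebesgue_on \<Omega>. (norm (Dp x))\<^sup>2) = \<beta>}"
    by (rule bdd_belowI[of _ 0]) (auto intro!: integral_nonneg_AE)
qed (use assms in blast)

text \<open>Here \<rho> determines \<beta>, as the energy of the normalised bump. The normalised
  negative part has energy \<open>(lam * I + J) / I = lam + J / I\<close>, and
  \<open>1 / 2 \<le> I\<close> yields the factor 2.\<close>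

lemma fucik_inf_le_cutoff:
  fixes \<Omega> :: "'a::euclidean_space set"
  assumes dom: "open \<Omega>" "bounded \<Omega>" and ef: "positive_eigenfunction \<Omega> lam e"
    and d: "ball a d \<subseteq> \<Omega>" and \<tau>: "\<And>x. x \<in> ball a d \<Longrightarrow> e x \<le> \<tau>"
    and small: "\<tau>\<^sup>2 * measure lebesgue (ball a d) \<le> 1 / 2"
    and \<rho>: "0 < \<rho>" "0 < n" "2 ^ n * \<rho> \<le> d"
    and \<beta>: "\<beta> = (LINT x|lborel. (norm (grad bump (x::'a)))\<^sup>2) / (LINT x|lborel. (bump (x::'a))\<^sup>2) / \<rho>\<^sup>2"
  shows "fucik_inf \<Omega> \<beta>
    \<le> lam + 2 * (LINT x|lebesgue_on \<Omega>. (e x)\<^sup>2 * (norm (grad (cutoff a \<rho> n) x))\<^sup>2)"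
proof -
  let ?\<eta> = "cutoff a \<rho> n"
  let ?b = "\<lambda>x. bump ((1 / \<rho>) *\<^sub>R (x - a))"
  let ?P = "LINT x|lborel. (bump (x::'a))\<^sup>2"
  let ?Q = "LINT x|lborel. (norm (grad bump (x::'a)))\<^sup>2"
  obtain De where e: "e \<in> H10 \<Omega>" and De: "has_weak_gradient \<Omega> e De"
    and weak: "\<And>v Dv. v \<in> H10 \<Omega> \<Longrightarrow> has_weak_gradient \<Omega> v Dv \<Longrightarrow>
      (LINT x|lebesgue_on \<Omega>. De x \<bullet> Dv x) = (LINT x|lebesgue_on \<Omega>. lam * e x * v x)"
    using ef unfolding positive_eigenfunction_def weak_dirichlet_solution_def by blast
  have pos: "0 < e x" if "x \<in> \<Omega>" for x
    using ef that by (simp add: positive_eigenfunction_def)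
  have e1: "L2_norm_on \<Omega> e = 1"
    using ef by (simp add: positive_eigenfunction_def)
  define I where "I = (LINT x|lebesgue_on \<Omega>. (e x * ?\<eta> x)\<^sup>2)"
  define J where "J = (LINT x|lebesgue_on \<Omega>. (e x)\<^sup>2 * (norm (grad ?\<eta> x))\<^sup>2)"
  have J: "0 \<le> J"
    unfolding J_def by (intro integral_nonneg_AE) auto
  have abs: "\<bar>e x\<bar> \<le> \<tau>" if "x \<in> \<Omega> \<inter> ball a d" for x
    using pos[of x] \<tau>[of x] that by simp
  have I: "1 / 2 \<le> I"
    unfolding I_def by (rule cutoff_mass[OF dom has_weak_gradientD(1)[OF De] e1 abs small \<rho>])
  define W where "W x = ?\<eta> x *\<^sub>R De x + e x *\<^sub>R grad ?\<eta> x" for x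
  have W: "has_weak_gradient \<Omega> (\<lambda>x. e x * ?\<eta> x) W"
    unfolding W_def[abs_def] by (rule has_weak_gradient_mult[OF dom De smooth_cutoff])
  have energy: "(LINT x|lebesgue_on \<Omega>. (norm (W x))\<^sup>2) = lam * I + J"
    unfolding W_def I_def J_def
    by (rule eigenfunction_cutoff_energy[OF dom e De weak smooth_cutoff])
  \<comment> \<open>Since \<open>n\<close> is positive, \<open>2 * \<rho> \<le> d\<close>, which
    places the closed support of the bump inside the open ball.\<close>
  have ball: "cball a \<rho> \<subseteq> \<Omega>"
  proof -
    have "2 ^ 1 \<le> (2::real) ^ n"
      using \<rho>(2) by (intro power_increasing) auto
    then have "2 * \<rho> \<le> 2 ^ n * \<rho>"
      using \<rho>(1) by (intro mult_right_mono) auto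
    then have "\<rho> < d" using \<rho> by linarith
    then have "cball a \<rho> \<subseteq> ball a d" by (auto simp: subset_eq)
    then show ?thesis using d by blast
  qed
  have b: "test_function \<Omega> ?b"
    using \<rho>(1) ball by (rule test_function_bump_scaled)
  note energies = bump_scaled_energies[OF dom_sets[OF dom] \<rho>(1) ball]
  have P: "0 < ?P" by (rule integral_bump_square_pos)
  define c1 where "c1 = 1 / sqrt (\<rho> ^ DIM('a) * ?P)"
  define c2 where "c2 = 1 / sqrt I"
  have c1: "0 < c1" "c1\<^sup>2 = 1 / (\<rho> ^ DIM('a) * ?P)"
    using P \<rho>(1) by (auto simp: c1_def power_divide)
  have c2: "0 < c2" "c2\<^sup>2 = 1 / I"
    using I by (auto simp: c2_def power_divide)
  define u where "u x = ?b x * c1 + e x * ?\<eta> x * (- c2)" for x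
  \<comment> \<open>The sphere of radius \<rho> separates the supports: within it the cutoff
    vanishes, beyond it the bump does.\<close>
  have split: "pos_part u x = ?b x * c1 \<and> neg_part u x = e x * ?\<eta> x * c2" if x: "x \<in> \<Omega>" for x
  proof (cases "norm (x - a) \<le> \<rho>")
    case True
    then have "?\<eta> x = 0" using \<rho>(1) by (intro cutoff_eq_0)
    moreover have "0 \<le> ?b x * c1"
      using bump_nonneg c1(1) by (intro mult_nonneg_nonneg) auto
    ultimately show ?thesis
      by (simp add: pos_part_def neg_part_def u_def)
  next
    case False
    then have "?b x = 0"
      using \<rho>(1) by (intro bump_eq_0) (simp add: divide_less_eq)
    moreover have "0 \<le> e x * ?\<eta> x * c2"
      using pos[OF x] cutoff_bounds(1)[of a \<rho> n x] c2(1) by simp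
    ultimately show ?thesis
      by (simp add: pos_part_def neg_part_def u_def)
  qed
  have u: "u \<in> H10 \<Omega>"
    unfolding u_def[abs_def]
    by (intro H10_add[OF dom] H10_mult[OF dom] test_function_in_H10[OF dom b] e smooth_cutoff smooth_const)
  have Dp: "has_weak_gradient \<Omega> (pos_part u) (\<lambda>x. c1 *\<^sub>R grad ?b x)"
    using has_weak_gradient_mult[OF dom has_weak_gradient_test_function[OF dom b] smooth_const[of c1]] split
    by (intro has_weak_gradient_cong[of \<Omega> "\<lambda>x. ?b x * c1" "pos_part u"]) auto
  have Dm: "has_weak_gradient \<Omega> (neg_part u) (\<lambda>x. c2 *\<^sub>R W x)"
    using has_weak_gradient_mult[OF dom W smooth_const[of c2]] split
    by (intro has_weak_gradient_cong[of \<Omega> "\<lambda>x. e x * ?\<eta> x * c2" "neg_part u"]) auto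
  have np: "L2_norm_on \<Omega> (pos_part u) = 1"
  proof -
    have "L2_norm_on \<Omega> (pos_part u) = L2_norm_on \<Omega> (\<lambda>x. ?b x * c1)"
      using split by (intro L2_norm_on_cong) simp
    also have "\<dots> = 1"
      using energies(1) c1(2) P \<rho>(1) by (intro L2_norm_on_eq_1) (simp add: power_mult_distrib)
    finally show ?thesis .
  qed
  have nm: "L2_norm_on \<Omega> (neg_part u) = 1"
  proof -
    have "L2_norm_on \<Omega> (neg_part u) = L2_norm_on \<Omega> (\<lambda>x. (e x * ?\<eta> x) * c2)"
      using split by (intro L2_norm_on_cong) simp
    also have "\<dots> = 1"
    proof (rule L2_norm_on_eq_1)
      have "(norm ((e x * ?\<eta> x) * c2))\<^sup>2 = (e x * ?\<eta> x)\<^sup>2 * c2\<^sup>2" for x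
        by (simp add: power_mult_distrib)
      then show "(LINT x|lebesgue_on \<Omega>. (norm ((e x * ?\<eta> x) * c2))\<^sup>2) = 1"
        using I c2(2) by (simp only: integral_mult_left_zero I_def[symmetric]) simp
    qed
    finally show ?thesis .
  qed
  have "(LINT x|lebesgue_on \<Omega>. (norm (c1 *\<^sub>R grad ?b x))\<^sup>2) = c1\<^sup>2 * (\<rho> ^ DIM('a) / \<rho>\<^sup>2 * ?Q)"
    using energies(2) by (simp add: power_mult_distrib)
  also have "\<dots> = \<beta>"
    using P \<rho>(1) by (simp add: c1(2) \<beta>)
  finally have "fucik_inf \<Omega> \<beta> \<le> (LINT x|lebesgue_on \<Omega>. (norm (c2 *\<^sub>R W x))\<^sup>2)"
    by (rule fucik_inf_le[OF u Dp Dm np nm])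
  also have "\<dots> = lam + J / I"
    using I energy by (simp add: power_mult_distrib c2(2) add_divide_distrib)
  also have "J / I \<le> 2 * J"
    using I J mult_left_mono[of 1 "2 * I" J] by (simp add: divide_le_eq mult_ac)
  finally show ?thesis by (simp add: J_def)
qed

section \<open>Choice of the ball and asymptotic bounds for the infimum\<close>

lemma exists_small_ball:
  fixes \<Omega> :: "'a::euclidean_space set"
  assumes dom: "open \<Omega>" "bounded \<Omega>" "\<Omega> \<noteq> {}" and e: "e \<in> H10 \<Omega>" "continuous_on \<Omega> e" and \<tau>: "0 < \<tau>"
  shows "\<exists>a d. 0 < d \<and> ball a d \<subseteq> \<Omega> \<and> (\<forall>x\<in>ball a d. e x \<le> \<tau>)
    \<and> \<tau>\<^sup>2 * measure lebesgue (ball a d) \<le> 1 / 2"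
proof -
  obtain a where a: "a \<in> \<Omega>" "e a < \<tau>"
    using H10_inf_nonpos[OF dom e(1) \<tau>] by blast
  have "open (\<Omega> \<inter> e -` {..<\<tau>})"
    using e(2) dom(1) by (intro continuous_open_preimage) auto
  then obtain r where r: "0 < r" "ball a r \<subseteq> \<Omega> \<inter> e -` {..<\<tau>}"
    using a by (metis IntI lessThan_iff open_contains_ball vimageI)
  let ?v = "unit_ball_vol DIM('a)"
  have v: "0 < ?v" by (simp add: unit_ball_vol_pos)
  \<comment> \<open>The bound 1 gives \<open>d ^ DIM('a) \<le> d\<close>, so a bound linear in
    \<open>d\<close> is enough to control the volume.\<close>
  define d where "d = min (min r 1) (1 / (2 * \<tau>\<^sup>2 * ?v))"
  have d: "0 < d" "d \<le> r" "d \<le> 1" "d \<le> 1 / (2 * \<tau>\<^sup>2 * ?v)"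
    using r \<tau> v by (auto simp: d_def)
  have "d ^ DIM('a) \<le> d ^ 1"
    using d(1,3) by (intro power_decreasing) (auto simp: Suc_le_eq)
  then have "\<tau>\<^sup>2 * (?v * d ^ DIM('a)) \<le> \<tau>\<^sup>2 * (?v * (1 / (2 * \<tau>\<^sup>2 * ?v)))"
    using d(4) v by (intro mult_left_mono) auto
  also have "\<dots> = 1 / 2" using \<tau> order_less_imp_not_eq2[OF v] by simp
  finally have "\<tau>\<^sup>2 * measure lebesgue (ball a d) \<le> 1 / 2"
    using content_ball[of d a] d(1) by simp
  moreover have "ball a d \<subseteq> \<Omega>" "\<forall>x\<in>ball a d. e x \<le> \<tau>"
    using r(2) d(2) subset_ball[of d r a] by fastforce+
  ultimately show ?thesis using d(1) by blast
qed

text \<open>The order of quantifiers is the point: \<open>A\<close> is fixed before \<epsilon>, so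
  the relation between \<rho> and \<beta> stays the same when a smaller \<epsilon> requires another
  ball and another \<open>d\<close>.\<close>

lemma fucik_inf_scales:
  fixes \<Omega> :: "'a::euclidean_space set"
  assumes dom: "open \<Omega>" "bounded \<Omega>" "\<Omega> \<noteq> {}" and ef: "positive_eigenfunction \<Omega> lam e"
  shows "\<exists>A>0. \<forall>\<epsilon>>0. \<exists>d>0. \<forall>\<rho> n. 0 < \<rho> \<longrightarrow> 0 < n \<longrightarrow> 2 ^ n * \<rho> \<le> d \<longrightarrow>
      fucik_inf \<Omega> (A / \<rho>\<^sup>2) \<le> lam + \<epsilon> * (\<Sum>j<n. (2 ^ j * \<rho>) ^ DIM('a) / (2 ^ j * \<rho>)\<^sup>2) / n\<^sup>2"
proof -
  let ?P = "LINT x|lborel. (bump (x::'a))\<^sup>2"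
  let ?Q = "LINT x|lborel. (norm (grad bump (x::'a)))\<^sup>2"
  obtain K where K: "0 < K" "\<forall>t. \<bar>grad step t\<bar> \<le> K" using grad_step_bound by blast
  \<comment> \<open>The 2 is the price of normalising the negative part; the bracket is the constant
    of \<open>cutoff_energy\<close> without \<open>\<tau>\<^sup>2\<close>.\<close>
  define C where "C = 2 * (16 * K\<^sup>2 * unit_ball_vol DIM('a) * 2 ^ DIM('a))"
  have C: "0 < C" using K(1) by (simp add: C_def)
  show ?thesis
  proof (rule exI[of _ "?Q / ?P"], intro conjI allI impI)
    show "0 < ?Q / ?P"
      using integral_bump_square_pos integral_grad_bump_pos by (rule divide_pos_pos[rotated])
    fix \<epsilon> :: real assume \<epsilon>: "0 < \<epsilon>"
    define \<tau> where "\<tau> = sqrt (\<epsilon> / C)"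
    have \<tau>: "0 < \<tau>" "C * \<tau>\<^sup>2 = \<epsilon>" using C \<epsilon> by (auto simp: \<tau>_def)
    have e: "e \<in> H10 \<Omega>" "continuous_on \<Omega> e" "\<forall>x\<in>\<Omega>. 0 < e x"
      using ef by (auto simp: positive_eigenfunction_def weak_dirichlet_solution_def)
    obtain a d where d: "0 < d" "ball a d \<subseteq> \<Omega>" "\<forall>x\<in>ball a d. e x \<le> \<tau>"
      "\<tau>\<^sup>2 * measure lebesgue (ball a d) \<le> 1 / 2"
      using exists_small_ball[OF dom e(1,2) \<tau>(1)] by blast
    show "\<exists>d>0. \<forall>\<rho> n. 0 < \<rho> \<longrightarrow> 0 < n \<longrightarrow> 2 ^ n * \<rho> \<le> d \<longrightarrow>
        fucik_inf \<Omega> (?Q / ?P / \<rho>\<^sup>2) \<le> lam + \<epsilon> * (\<Sum>j<n. (2 ^ j * \<rho>) ^ DIM('a) / (2 ^ j * \<rho>)\<^sup>2) / n\<^sup>2"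
    proof (intro exI conjI allI impI)
      fix \<rho> :: real and n :: nat
      assume \<rho>: "0 < \<rho>" "0 < n" "2 ^ n * \<rho> \<le> d"
      let ?S = "(\<Sum>j<n. (2 ^ j * \<rho>) ^ DIM('a) / (2 ^ j * \<rho>)\<^sup>2)"
      have abs: "\<bar>e x\<bar> \<le> \<tau>" if "x \<in> \<Omega> \<inter> ball a d" for x
        using that d(3) e(3) by (simp add: less_imp_le)
      have "fucik_inf \<Omega> (?Q / ?P / \<rho>\<^sup>2)
          \<le> lam + 2 * (LINT x|lebesgue_on \<Omega>. (e x)\<^sup>2 * (norm (grad (cutoff a \<rho> n) x))\<^sup>2)"
        using d(3) by (intro fucik_inf_le_cutoff[OF dom(1,2) ef d(2) _ d(4) \<rho> refl]) blast
      also have "(LINT x|lebesgue_on \<Omega>. (e x)\<^sup>2 * (norm (grad (cutoff a \<rho> n) x))\<^sup>2)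
          \<le> 16 * K\<^sup>2 * \<tau>\<^sup>2 * unit_ball_vol DIM('a) * 2 ^ DIM('a) * ?S / n\<^sup>2"
        by (rule cutoff_energy[OF dom(1,2) K(2) \<rho>(1,3) abs])
      also have "lam + 2 * (16 * K\<^sup>2 * \<tau>\<^sup>2 * unit_ball_vol DIM('a) * 2 ^ DIM('a) * ?S / n\<^sup>2)
          = lam + \<epsilon> * ?S / n\<^sup>2"
        by (simp add: \<tau>(2)[symmetric] C_def mult_ac)
      finally show "fucik_inf \<Omega> (?Q / ?P / \<rho>\<^sup>2) \<le> lam + \<epsilon> * ?S / n\<^sup>2" by simp
    qed (fact d(1))
  qed
qed

text \<open>A single cutoff suffices: for \<open>n = 1\<close> the bound is a multiple of
  \<open>\<rho> ^ DIM('a) / \<rho>\<^sup>2\<close>, and \<open>\<rho> = sqrt (A / \<beta>)\<close>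
  turns this into the required negative power of \<beta>.\<close>

lemma fucik_inf_asymptotics_ge_3:
  fixes \<Omega> :: "'a::euclidean_space set"
  assumes dom: "open \<Omega>" "bounded \<Omega>" "\<Omega> \<noteq> {}" and ef: "positive_eigenfunction \<Omega> lam e"
    and dim: "DIM('a) \<ge> 3" and \<delta>: "0 < \<delta>"
  shows "\<forall>\<^sub>F \<beta> in at_top. \<beta> powr ((real DIM('a) - 2) / 2) * (fucik_inf \<Omega> \<beta> - lam) \<le> \<delta>"
proof -
  let ?p = "(real DIM('a) - 2) / 2"
  obtain A where A: "0 < A" and scales: "\<And>\<epsilon>. 0 < \<epsilon> \<Longrightarrow> \<exists>d>0. \<forall>\<rho> n. 0 < \<rho> \<longrightarrow> 0 < n \<longrightarrow> 2 ^ n * \<rho> \<le> d \<longrightarrow>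
      fucik_inf \<Omega> (A / \<rho>\<^sup>2) \<le> lam + \<epsilon> * (\<Sum>j<n. (2 ^ j * \<rho>) ^ DIM('a) / (2 ^ j * \<rho>)\<^sup>2) / n\<^sup>2"
    using fucik_inf_scales[OF dom ef] by blast
  \<comment> \<open>Compensates the factor \<open>A powr ?p\<close> that appears when \<rho> is
    expressed through \<beta>.\<close>
  define \<epsilon> where "\<epsilon> = \<delta> / A powr ?p"
  have \<epsilon>: "0 < \<epsilon>" using A \<delta> by (simp add: \<epsilon>_def)
  obtain d where d: "0 < d" and le: "\<And>\<rho> n. 0 < \<rho> \<Longrightarrow> 0 < n \<Longrightarrow> 2 ^ n * \<rho> \<le> d \<Longrightarrow>
      fucik_inf \<Omega> (A / \<rho>\<^sup>2) \<le> lam + \<epsilon> * (\<Sum>j<n. (2 ^ j * \<rho>) ^ DIM('a) / (2 ^ j * \<rho>)\<^sup>2) / n\<^sup>2"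
    using scales[OF \<epsilon>] by blast
  show ?thesis
    \<comment> \<open>Beyond this threshold \<open>2 * \<rho> \<le> d\<close>, the admissibility
      condition for \<open>n = 1\<close>.\<close>
    using eventually_ge_at_top[of "4 * A / d\<^sup>2"] eventually_gt_at_top[of 0]
  proof eventually_elim
    case (elim \<beta>)
    define \<rho> where "\<rho> = sqrt (A / \<beta>)"
    have \<rho>: "0 < \<rho>" "\<rho>\<^sup>2 = A / \<beta>" using A elim by (auto simp: \<rho>_def)
    have "(2 * \<rho>)\<^sup>2 \<le> d\<^sup>2"
      using elim d A by (simp add: power_mult_distrib \<rho>(2) field_simps)
    then have "2 ^ 1 * \<rho> \<le> d"
      using power2_le_imp_le[of "2 * \<rho>" d] d by simp
    from le[OF \<rho>(1) _ this]
    have "fucik_inf \<Omega> (A / \<rho>\<^sup>2) \<le> lam + \<epsilon> * (\<rho> ^ DIM('a) / \<rho>\<^sup>2)" by simp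
    moreover have "A / \<rho>\<^sup>2 = \<beta>" using A elim by (simp add: \<rho>(2))
    moreover have "\<rho> ^ DIM('a) / \<rho>\<^sup>2 = A powr ?p / \<beta> powr ?p"
    proof -
      have "\<rho> ^ DIM('a) / \<rho>\<^sup>2 = \<rho> powr (real DIM('a) - 2)"
        using \<rho>(1) by (simp add: powr_diff powr_realpow)
      also have "\<dots> = (A / \<beta>) powr ?p"
        using A elim by (simp add: \<rho>_def powr_half_sqrt[symmetric] powr_powr)
      also have "\<dots> = A powr ?p / \<beta> powr ?p"
        using A elim by (simp add: powr_divide)
      finally show ?thesis .
    qed
    ultimately have "fucik_inf \<Omega> \<beta> - lam \<le> \<delta> / \<beta> powr ?p"
      using A by (simp add: \<epsilon>_def)
    then show ?case using elim by (simp add: le_divide_eq mult.commute)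
  qed
qed

text \<open>In the plane every scale contributes 1, so the bound is \<epsilon> / n. The number
  \<open>n\<close> counts the doublings that fit between \<rho> and \<open>d\<close>, which grows
  like a multiple of ln \<beta>.\<close>

lemma fucik_inf_asymptotics_2:
  fixes \<Omega> :: "'a::euclidean_space set"
  assumes dom: "open \<Omega>" "bounded \<Omega>" "\<Omega> \<noteq> {}" and ef: "positive_eigenfunction \<Omega> lam e"
    and dim: "DIM('a) = 2" and \<delta>: "0 < \<delta>"
  shows "\<forall>\<^sub>F \<beta> in at_top. ln \<beta> * (fucik_inf \<Omega> \<beta> - lam) \<le> \<delta>"
proof -
  obtain A where A: "0 < A" and scales: "\<And>\<epsilon>. 0 < \<epsilon> \<Longrightarrow> \<exists>d>0. \<forall>\<rho> n. 0 < \<rho> \<longrightarrow> 0 < n \<longrightarrow> 2 ^ n * \<rho> \<le> d \<longrightarrow>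
      fucik_inf \<Omega> (A / \<rho>\<^sup>2) \<le> lam + \<epsilon> * (\<Sum>j<n. (2 ^ j * \<rho>) ^ DIM('a) / (2 ^ j * \<rho>)\<^sup>2) / n\<^sup>2"
    using fucik_inf_scales[OF dom ef] by blast
  \<comment> \<open>The 4 matches the lower bound \<open>ln \<beta> / 4 \<le> real n\<close>
    below.\<close>
  have \<epsilon>: "0 < \<delta> / 4" using \<delta> by simp
  obtain d where d: "0 < d" and le: "\<And>\<rho> n. 0 < \<rho> \<Longrightarrow> 0 < n \<Longrightarrow> 2 ^ n * \<rho> \<le> d \<Longrightarrow>
      fucik_inf \<Omega> (A / \<rho>\<^sup>2) \<le> lam + \<delta> / 4 * (\<Sum>j<n. (2 ^ j * \<rho>) ^ DIM('a) / (2 ^ j * \<rho>)\<^sup>2) / n\<^sup>2"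
    using scales[OF \<epsilon>] by blast
  \<comment> \<open>\<open>ln (d / \<rho>)\<close> grows like \<open>ln \<beta> / 2\<close>. Giving
    up half of that absorbs the constants \<open>ln d\<close> and \<open>ln A / 2\<close> and leaves
    1 to pay for the floor in \<open>n\<close>; \<open>1 \<le> ln \<beta>\<close> makes
    \<open>n\<close> positive.\<close>
  have "\<forall>\<^sub>F \<beta> in at_top. max 1 (4 * (1 - ln d + ln A / 2)) \<le> ln (\<beta>::real)"
    using ln_at_top unfolding filterlim_at_top by blast
  then show ?thesis
    using eventually_gt_at_top[of 0]
  proof eventually_elim
    case (elim \<beta>)
    define \<rho> where "\<rho> = sqrt (A / \<beta>)"
    have \<rho>: "0 < \<rho>" "\<rho>\<^sup>2 = A / \<beta>" using A elim by (auto simp: \<rho>_def)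
    define y where "y = ln (d / \<rho>)"
    have "y = ln d - ln A / 2 + ln \<beta> / 2"
      using A d elim by (simp add: y_def \<rho>_def ln_div ln_sqrt diff_divide_distrib)
    then have y: "1 + ln \<beta> / 4 \<le> y" "1 \<le> ln \<beta>" using elim by (auto simp: field_simps)
    have ln2: "0 < ln (2::real)" "ln (2::real) \<le> 1"
      using ln_2_less_1 by auto
    define n where "n = nat \<lfloor>y / ln 2\<rfloor>"
    have "y \<le> y / ln 2"
      using y ln2 mult_left_mono[of "ln 2" 1 y] by (simp add: le_divide_eq)
    moreover have "real n = of_int \<lfloor>y / ln 2\<rfloor>"
      using y ln2 by (simp add: n_def)
    ultimately have n: "ln \<beta> / 4 \<le> real n" "real n \<le> y / ln 2"
      using y(1) by linarith+
    have n0: "0 < n" using n(1) y(2) by (cases "n = 0") auto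
    have "(2::real) ^ n = exp (real n * ln 2)"
      by (simp add: powr_realpow[symmetric] powr_def)
    also have "\<dots> \<le> exp y"
      using n(2) ln2 by (simp add: le_divide_eq)
    also have "\<dots> = d / \<rho>" using d \<rho>(1) by (simp add: y_def)
    finally have "2 ^ n * \<rho> \<le> d" using \<rho>(1) by (simp add: le_divide_eq)
    from le[OF \<rho>(1) n0 this]
    have "fucik_inf \<Omega> (A / \<rho>\<^sup>2) \<le> lam + \<delta> / 4 * (\<Sum>j<n. 1) / n\<^sup>2"
      using \<rho>(1) by (simp add: dim)
    moreover have "A / \<rho>\<^sup>2 = \<beta>" using A elim by (simp add: \<rho>(2))
    ultimately have "fucik_inf \<Omega> \<beta> - lam \<le> \<delta> / 4 / n"
      using n0 by (simp add: power2_eq_square)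
    also have "\<dots> \<le> \<delta> / 4 / (ln \<beta> / 4)"
      using n n0 y(2) \<delta> by (intro divide_left_mono mult_pos_pos) auto
    finally show ?case using y(2) by (simp add: le_divide_eq mult.commute)
  qed
qed

section \<open>Comparison with the known limits\<close>

lemma less_ereal_limit:
  assumes "((\<lambda>x. ereal (f x)) \<longlongrightarrow> l) F" "0 < l"
  shows "\<exists>\<delta>>0. \<forall>\<^sub>F x in F. \<delta> < f x"
proof -
  \<comment> \<open>The limit may be infinite, so a real number is inserted between 0 and
    it.\<close>
  obtain \<delta> where \<delta>: "0 < ereal \<delta>" "ereal \<delta> < l"
    using ereal_dense2[OF assms(2)] by blast
  have "\<forall>\<^sub>F x in F. \<delta> < f x"
    using order_tendstoD(1)[OF assms(1) \<delta>(2)] by simp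
  then show ?thesis using \<delta>(1) by auto
qed

lemma max_on_pos:
  assumes "\<Omega> \<noteq> {}" "\<forall>x\<in>\<Omega>. 0 < e x"
  shows "0 < max_on \<Omega> e"
  using assms unfolding max_on_def less_SUP_iff by (auto simp: zero_ereal_def)

text \<open>The maximum is an extended real and may be infinite, hence the case distinction on
  \<open>m\<close>.\<close>

lemma ereal_limit_pos:
  fixes m :: ereal
  assumes "0 < c" "0 < m" "1 \<le> k"
  shows "0 < ereal c * m\<^sup>2 * ereal (real k)"
  using assms by (cases m) auto

theorem corollary3p4:
  fixes \<Omega> :: "'a::euclidean_space set"
    and lam1 :: real and e1 :: "'a \<Rightarrow> real"
    and b :: "nat \<Rightarrow> real" and \<alpha> :: "nat \<Rightarrow> real \<Rightarrow> real" and u :: "nat \<Rightarrow> real \<Rightarrow> 'a \<Rightarrow> real"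
  assumes dim: "DIM('a) \<ge> 2"
    and domain: "open \<Omega>" "connected \<Omega>" "bounded \<Omega>" "\<Omega> \<noteq> {}"
    and lambda1: "first_eigenvalue \<Omega> lam1"
    and e1: "positive_eigenfunction \<Omega> lam1 e1"
    and spectrum: "\<And>k \<beta>. k \<ge> 1 \<Longrightarrow> \<beta> > b k \<Longrightarrow> (\<alpha> k \<beta>, \<beta>) \<in> fucik_spectrum \<Omega>"
    and solutions: "family_solutions \<Omega> lam1 e1 b \<alpha> u"
    and peaks: "family_peaks \<Omega> e1 b u"
    and asymptotics: "family_asymptotics \<Omega> lam1 e1 \<alpha>"
  shows "\<forall>k\<ge>1. \<exists>b'>0. b' \<ge> max (b k) lam1 \<and> (\<forall>\<beta>>b'. fucik_inf \<Omega> \<beta> < \<alpha> k \<beta>)"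
proof (intro allI impI)
  fix k :: nat assume k: "1 \<le> k"
  note dom = domain(1,3,4)
  have m: "0 < max_on \<Omega> e1"
    using domain(4) e1 by (intro max_on_pos) (auto simp: positive_eigenfunction_def)
  have "\<forall>\<^sub>F \<beta> in at_top. fucik_inf \<Omega> \<beta> < \<alpha> k \<beta>"
  proof (cases "DIM('a) = 2")
    case True
    then have lim: "((\<lambda>\<beta>. ereal (ln \<beta> * (\<alpha> k \<beta> - lam1)))
        \<longlongrightarrow> ereal (4 * pi) * (max_on \<Omega> e1)\<^sup>2 * ereal (real k)) at_top"
      using asymptotics k by (simp add: family_asymptotics_def)
    \<comment> \<open>The same \<delta> is a strict lower bound for the \<open>\<alpha>\<close> side
      and the prescribed upper bound for the \<open>fucik_inf\<close> side; the common positive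
      factor is then cancelled.\<close>
    then obtain \<delta> where \<delta>: "0 < \<delta>" "\<forall>\<^sub>F \<beta> in at_top. \<delta> < ln \<beta> * (\<alpha> k \<beta> - lam1)"
      using less_ereal_limit[OF lim ereal_limit_pos[OF _ m k]] by auto
    show ?thesis
      using \<delta>(2) fucik_inf_asymptotics_2[OF dom e1 True \<delta>(1)] eventually_gt_at_top[of 1]
    proof eventually_elim
      case (elim \<beta>)
      then have "ln \<beta> * (fucik_inf \<Omega> \<beta> - lam1) < ln \<beta> * (\<alpha> k \<beta> - lam1)" by linarith
      then show ?case using elim by simp
    qed
  next
    case False
    then have dim3: "DIM('a) \<ge> 3" using dim by linarith
    let ?p = "(real DIM('a) - 2) / 2"
    obtain c where c: "0 < c" "((\<lambda>\<beta>. ereal (\<beta> powr ?p * (\<alpha> k \<beta> - lam1)))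
        \<longlongrightarrow> ereal c * (max_on \<Omega> e1)\<^sup>2 * ereal (real k)) at_top"
      using asymptotics k dim3 unfolding family_asymptotics_def by blast
    then obtain \<delta> where \<delta>: "0 < \<delta>" "\<forall>\<^sub>F \<beta> in at_top. \<delta> < \<beta> powr ?p * (\<alpha> k \<beta> - lam1)"
      using less_ereal_limit[OF c(2) ereal_limit_pos[OF c(1) m k]] by blast
    show ?thesis
      using \<delta>(2) fucik_inf_asymptotics_ge_3[OF dom e1 dim3 \<delta>(1)] eventually_gt_at_top[of 0]
    proof eventually_elim
      case (elim \<beta>)
      then have "\<beta> powr ?p * (fucik_inf \<Omega> \<beta> - lam1) < \<beta> powr ?p * (\<alpha> k \<beta> - lam1)" by linarith
      then show ?case using elim by simp
    qed
  qed
  then obtain B where B: "\<And>\<beta>. B \<le> \<beta> \<Longrightarrow> fucik_inf \<Omega> \<beta> < \<alpha> k \<beta>"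
    unfolding eventually_at_top_linorder by blast
  show "\<exists>b'>0. b' \<ge> max (b k) lam1 \<and> (\<forall>\<beta>>b'. fucik_inf \<Omega> \<beta> < \<alpha> k \<beta>)"
    \<comment> \<open>\<open>B\<close> is the threshold of the eventual inequality, and the 1 makes
      the witness positive.\<close>
    by (rule exI[of _ "max (max (b k) lam1) (max B 1)"]) (auto intro: B)
qed

end
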